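(* Let $d\ge1$ be an integer and let $q>p>0$ be such that $q\in(p,2p)$ if $p\ge d/2$, and $q\in(p,dp/(d-p))$ if $p\in(0,d/2]$. Let $\mu\in\mathcal{P}(\mathbb{R}^d)$, let $(X_k)_{k\ge1}$ be i.i.d. $\mu$-distributed random variables and $\mu_N=\frac1N\sum_{k=1}^N\delta_{X_k}$. Then for all $N\ge1$, $$\mathbb{E}[\mathcal{T}_p^{(\infty)}(\mu_N,\mu)]\le 2^p[\mathcal{M}_q^{(\infty)}(\mu)]^{p/q}\frac{\zeta_{d,p,q}^{(\infty)}}{N^{(q-p)/q}},$$ where, setting $\varepsilon_p=\max\{2^{-1},2^{-p}\}$, $$\zeta_{d,p,q}^{(\infty)}=\Big[\varepsilon_p2^{2p/q-1}+\Big(\frac{2^{d-1}}{2^{d/2}-1}\Big)^{2(q-p)/q}\frac{1-2^{-p}}{1-2^{d-p-dp/q}}\Big]\min_{a\in(1,\infty)}\Big(\frac{a^p}{a^{p-q/2}-1}+\frac{a^p}{1-a^{p-q}}\Big).$$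
   Context: $\mathcal{P}(\mathbb{R}^d)$ is the set of Borel probability measures on $\mathbb{R}^d$, and $|x|_\infty=\max\{|x_1|,\dots,|x_d|\}$. For $\mu,\nu\in\mathcal{P}(\mathbb{R}^d)$, $$\mathcal{T}_p^{(\infty)}(\mu,\nu)=\inf\Big\{\int_{\mathbb{R}^d\times\mathbb{R}^d}|x-y|_\infty^p\,\xi(dx,dy):\xi\in\mathcal{H}(\mu,\nu)\Big\},$$ where $\mathcal{H}(\mu,\nu)$ is the set of probability measures on $\mathbb{R}^d\times\mathbb{R}^d$ with marginals $\mu$ and $\nu$. Also $\mathcal{M}_q^{(\infty)}(\mu)=\int_{\mathbb{R}^d}|x|_\infty^q\,\mu(dx)\in[0,\infty]$ (if it is infinite, the right-hand side of the bound is $+\infty$). *)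

theory Defs
  imports "HOL-Probability.Probability"
begin

text \<open>
  Real powers of extended nonnegative numbers, only meant for exponents \<open>a > 0\<close>, with
  \<open>\<infinity>\<^sup>a = \<infinity>\<close> and \<open>0\<^sup>a = 0\<close>.
\<close>

definition ennreal_powr :: "ennreal \<Rightarrow> real \<Rightarrow> ennreal" where
  "ennreal_powr x a = (if x = \<top> then \<top> else ennreal (enn2real x powr a))"

text \<open>
  The maximum norm on \<open>real ^ 'n\<close> is the library's \<^const>\<open>infnorm\<close>.
\<close>

lemma infnorm_eq_Max: "infnorm (x :: real ^ 'n) = Max (range (\<lambda>i. \<bar>x $ i\<bar>))"
proof -
  have "infnorm x = Sup (range (\<lambda>i. \<bar>x $ i\<bar>))"
    unfolding infnorm_cart by (simp add: full_SetCompr_eq)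
  then show ?thesis
    by (simp add: cSup_eq_Max)
qed

definition couplings ::
  "(real ^ 'n) measure \<Rightarrow> (real ^ 'n) measure \<Rightarrow> ((real ^ 'n) \<times> (real ^ 'n)) measure set" where
  "couplings \<mu> \<nu> =
     {\<xi>. prob_space \<xi> \<and> sets \<xi> = sets (borel \<Otimes>\<^sub>M borel) \<and>
         distr \<xi> borel fst = \<mu> \<and> distr \<xi> borel snd = \<nu>}"

definition transport_cost ::
  "real \<Rightarrow> (real ^ 'n) measure \<Rightarrow> (real ^ 'n) measure \<Rightarrow> ennreal" where
  "transport_cost p \<mu> \<nu> =
     (INF \<xi>\<in>couplings \<mu> \<nu>. \<integral>\<^sup>+ (x, y). ennreal (infnorm (x - y) powr p) \<partial>\<xi>)"

definition moment :: "real \<Rightarrow> (real ^ 'n) measure \<Rightarrow> ennreal" where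
  "moment q \<mu> = (\<integral>\<^sup>+ x. ennreal (infnorm x powr q) \<partial>\<mu>)"

text \<open>
  The normalised sum of the Dirac measures \<open>return borel (x k)\<close>, \<open>1 \<le> k \<le> N\<close>. The set
  function below is a measure, see \<open>emeasure_empirical_measure\<close>.
\<close>

definition empirical_measure :: "nat \<Rightarrow> (nat \<Rightarrow> real ^ 'n) \<Rightarrow> (real ^ 'n) measure" where
  "empirical_measure N x =
     measure_of UNIV (sets borel)
       (\<lambda>A. ennreal (1 / real N) * (\<Sum>k=1..N. emeasure (return borel (x k)) A))"

lemma sets_empirical_measure [simp, measurable_cong]:
  "sets (empirical_measure N x) = sets borel"
  unfolding empirical_measure_def
  by (metis sets.sets_measure_of_eq space_borel)

lemma space_empirical_measure [simp]: "space (empirical_measure N x) = UNIV"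
  using sets_eq_imp_space_eq[OF sets_empirical_measure[of N x]] by simp

lemma emeasure_empirical_measure:
  fixes x :: "nat \<Rightarrow> real ^ 'n"
  assumes "A \<in> sets borel"
  shows "emeasure (empirical_measure N x) A =
           ennreal (1 / real N) * (\<Sum>k=1..N. emeasure (return borel (x k)) A)"
proof (rule emeasure_measure_of[OF empirical_measure_def])
  show "sets borel \<subseteq> Pow (UNIV :: (real ^ 'n) set)" by simp
  show "A \<in> sets (empirical_measure N x)" using assms by simp
  show "positive (sets (empirical_measure N x))
          (\<lambda>A. ennreal (1 / real N) * (\<Sum>k=1..N. emeasure (return borel (x k)) A))"
    by (simp add: positive_def)
  show "countably_additive (sets (empirical_measure N x))
          (\<lambda>A. ennreal (1 / real N) * (\<Sum>k=1..N. emeasure (return borel (x k)) A))"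
  proof (rule countably_additiveI)
    fix B :: "nat \<Rightarrow> (real ^ 'n) set"
    assume B: "range B \<subseteq> sets (empirical_measure N x)" "disjoint_family B"
    have "(\<Sum>i. ennreal (1 / real N) * (\<Sum>k=1..N. emeasure (return borel (x k)) (B i)))
        = ennreal (1 / real N) * (\<Sum>k=1..N. \<Sum>i. emeasure (return borel (x k)) (B i))"
      by (simp add: ennreal_suminf_cmult suminf_sum)
    also have "(\<Sum>k=1..N. \<Sum>i. emeasure (return borel (x k)) (B i))
        = (\<Sum>k=1..N. emeasure (return borel (x k)) (\<Union>i. B i))"
      using B by (intro sum.cong refl suminf_emeasure) auto
    finally show "(\<Sum>i. ennreal (1 / real N) * (\<Sum>k=1..N. emeasure (return borel (x k)) (B i)))
        = ennreal (1 / real N) * (\<Sum>k=1..N. emeasure (return borel (x k)) (\<Union>i. B i))" .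
  qed
qed

lemma prob_space_empirical_measure:
  assumes "N \<ge> 1"
  shows "prob_space (empirical_measure N x)"
proof (rule prob_spaceI)
  have "ennreal (1 / real N) * ennreal (real N) = ennreal (1 / real N * real N)"
    by (rule ennreal_mult[symmetric]) auto
  also have "\<dots> = 1"
    using assms by simp
  finally have "ennreal (1 / real N) * of_nat N = 1"
    by (simp only: ennreal_of_nat_eq_real_of_nat)
  then show "emeasure (empirical_measure N x) (space (empirical_measure N x)) = 1"
    by (simp add: emeasure_empirical_measure)
qed

definition zeta_fun :: "real \<Rightarrow> real \<Rightarrow> real \<Rightarrow> real" where
  "zeta_fun p q a = a powr p / (a powr (p - q / 2) - 1) + a powr p / (1 - a powr (p - q))"

definition eps_const :: "real \<Rightarrow> real" where
  "eps_const p = max (2 powr (-1)) (2 powr (- p))"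

text \<open>
  The infimum in the following definition is a minimum when \<open>0 < p < q < 2 p\<close>, see
  \<open>zeta_fun_attains_min\<close>.
\<close>

definition zeta_const :: "nat \<Rightarrow> real \<Rightarrow> real \<Rightarrow> real" where
  "zeta_const d p q =
     (eps_const p * 2 powr (2 * p / q - 1)
      + (2 powr (real d - 1) / (2 powr (real d / 2) - 1)) powr (2 * (q - p) / q)
        * ((1 - 2 powr (- p)) / (1 - 2 powr (real d - p - real d * p / q))))
     * (INF a\<in>{1<..}. zeta_fun p q a)"

lemma zeta_fun_pos:
  assumes "0 < p" "p < q" "q < 2 * p" "1 < a"
  shows "0 < zeta_fun p q a"
proof -
  have "a powr (p - q / 2) > 1" "a powr (p - q) < 1"
    using assms by (auto intro: gr_one_powr simp: powr_less_one)
  then show ?thesis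
    unfolding zeta_fun_def using assms by (intro add_pos_pos divide_pos_pos) auto
qed

lemma zeta_fun_attains_min:
  assumes "0 < p" "p < q" "q < 2 * p"
  obtains b where "1 < b" "\<And>a. 1 < a \<Longrightarrow> zeta_fun p q b \<le> zeta_fun p q a"
    "(INF a\<in>{1<..}. zeta_fun p q a) = zeta_fun p q b"
proof -
  let ?f = "zeta_fun p q"
  have lower: "?f a \<ge> a powr p" "?f a \<ge> 1 / (a powr (p - q / 2) - 1)" if "a > 1" for a
  proof -
    have 1: "a powr (p - q / 2) > 1" "0 < a powr (p - q)" "a powr (p - q) < 1" "a powr p > 1"
      using assms that by (auto intro: gr_one_powr simp: powr_less_one)
    have 2: "a powr p / (1 - a powr (p - q)) \<ge> a powr p"
      using 1 by (simp add: pos_le_divide_eq mult_le_cancel_left1)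
    have 3: "a powr p / (a powr (p - q / 2) - 1) \<ge> 1 / (a powr (p - q / 2) - 1)"
      using 1 by (intro divide_right_mono) auto
    have 4: "1 / (a powr (p - q / 2) - 1) > 0" using 1 by simp
    show "?f a \<ge> a powr p" "?f a \<ge> 1 / (a powr (p - q / 2) - 1)"
      unfolding zeta_fun_def using 1 2 3 4 by linarith+
  qed
  define C where "C = ?f 2"
  have C: "C > 0" unfolding C_def using assms by (intro zeta_fun_pos) auto
  define r where "r = p - q / 2"
  have r: "r > 0" using assms by (simp add: r_def)
  define l where "l = min 2 ((1 + 1 / C) powr (1 / r))"
  define u where "u = max 2 (C powr (1 / p))"
  have l: "l > 1" unfolding l_def using C r by (auto intro: gr_one_powr)
  have lu: "l \<le> 2" "2 \<le> u" by (auto simp: l_def u_def)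
  have out: "?f a \<ge> C" if "a > 1" "a \<notin> {l..u}" for a
  proof (cases "a < l")
    case True
    then have "a powr r \<le> ((1 + 1 / C) powr (1 / r)) powr r"
      using that r by (intro powr_mono2) (auto simp: l_def)
    also have "\<dots> = 1 + 1 / C" using r C by (simp add: powr_powr)
    finally have *: "a powr r - 1 \<le> 1 / C" by simp
    have "a powr r > 1" using that r by (auto intro: gr_one_powr)
    then have "C \<le> 1 / (a powr r - 1)" using * C
      by (simp add: field_simps)
    then show ?thesis using lower(2)[OF that(1)] by (simp add: r_def)
  next
    case False
    then have "C powr (1 / p) \<le> a" using that by (auto simp: u_def)
    then have "(C powr (1 / p)) powr p \<le> a powr p"
      using assms by (intro powr_mono2) auto
    then have "C \<le> a powr p" using assms C by (simp add: powr_powr)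
    then show ?thesis using lower(1)[OF that(1)] by simp
  qed
  have "continuous_on {l..u} ?f"
  proof -
    have "a powr (p - q / 2) - 1 \<noteq> 0" "1 - a powr (p - q) \<noteq> 0" if "a \<ge> l" for a
    proof -
      have "a powr (p - q / 2) > 1" "a powr (p - q) < 1"
        using assms that l by (auto intro: gr_one_powr simp: powr_less_one)
      then show "a powr (p - q / 2) - 1 \<noteq> 0" "1 - a powr (p - q) \<noteq> 0" by auto
    qed
    then show ?thesis
      unfolding zeta_fun_def using l by (intro continuous_intros) auto
  qed
  then obtain b where b: "b \<in> {l..u}" "\<And>a. a \<in> {l..u} \<Longrightarrow> ?f b \<le> ?f a"
    using continuous_attains_inf[of "{l..u}" ?f] lu by auto
  have "?f b \<le> C" using b(2)[of 2] lu by (simp add: C_def)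
  then have min: "?f b \<le> ?f a" if "1 < a" for a
    using b(2)[of a] out[OF that] by (cases "a \<in> {l..u}") auto
  have b1: "1 < b" using b l by auto
  have "(INF a\<in>{1<..}. ?f a) = ?f b"
    using b1 min by (intro cInf_eq_minimum) auto
  with b1 min that show ?thesis by blast
qed

lemma zeta_const_pos:
  assumes "0 < p" "p < q" "d \<ge> 1"
    and "p \<ge> real d / 2 \<Longrightarrow> q < 2 * p"
    and "p \<le> real d / 2 \<Longrightarrow> q < real d * p / (real d - p)"
  shows "0 < zeta_const d p q"
proof -
  have q2p: "q < 2 * p" and expo: "real d - p - real d * p / q < 0"
  proof -
    have "q < 2 * p \<and> q * (real d - p) < real d * p"
    proof (cases "p \<ge> real d / 2")
      case True
      then have q: "q < 2 * p" using assms by blast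
      have "q * (real d - p) < real d * p"
      proof (cases "real d \<le> p")
        case True
        then have "q * (real d - p) \<le> 0" using assms by (intro mult_nonneg_nonpos) auto
        also have "0 < real d * p" using assms by simp
        finally show ?thesis .
      next
        case False
        then have "q * (real d - p) < (2 * p) * (real d - p)"
          using q by (intro mult_strict_right_mono) auto
        also have "\<dots> = p * (2 * (real d - p))" by simp
        also have "\<dots> \<le> p * real d"
          using True assms by (intro mult_left_mono) auto
        finally show ?thesis by (simp add: mult.commute)
      qed
      with q show ?thesis by blast
    next
      case False
      then have dp: "real d - p > 0" "real d \<le> 2 * (real d - p)" using assms by auto
      have q: "q * (real d - p) < real d * p"
        using assms(5) False dp by (simp add: pos_less_divide_eq)
      also have "\<dots> \<le> (2 * (real d - p)) * p"
        using dp assms by (intro mult_right_mono) auto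
      finally have "q * (real d - p) < (2 * p) * (real d - p)" by (simp add: mult_ac)
      then have "q < 2 * p" using dp by (simp add: mult_less_cancel_right)
      with q show ?thesis by blast
    qed
    then show "q < 2 * p" "real d - p - real d * p / q < 0"
      using assms by (auto simp: field_simps)
  qed
  obtain b where b: "1 < b" "(INF a\<in>{1<..}. zeta_fun p q a) = zeta_fun p q b"
    using zeta_fun_attains_min assms(1,2) q2p by metis
  have "zeta_fun p q b > 0" using zeta_fun_pos assms(1,2) q2p b(1) by blast
  moreover have "2 powr (real d - p - real d * p / q) < 1" "2 powr (- p) < 1"
    using expo assms(1) by (simp_all add: powr_less_one)
  moreover have "eps_const p > 0" by (simp add: eps_const_def less_max_iff_disj)
  ultimately show ?thesis
    unfolding zeta_const_def b(2) by (intro mult_pos_pos add_pos_nonneg mult_nonneg_nonneg divide_nonneg_nonneg) auto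
qed

end

theory Submission
  imports Defs
begin

text \<open>
  The space is cut into the annuli \<open>a\<^sup>n \<le> |x| < a\<^sup>n\<^sup>+\<^sup>1\<close>, \<open>n \<in> \<int>\<close>, for a ratio \<open>a > 1\<close> that is chosen
  at the very end, and each annulus is cut, at level \<open>l\<close>, by the \<open>2\<^sup>d\<^sup>l\<close> dyadic subcubes of the cube
  that encloses it.

  Match as much mass as possible inside the finest cells, then match what is left as
  well as possible inside the next coarser cells, and so on; at the end the rest is matched
  arbitrarily. Earlier matches stay inside one cell of every coarser level, so this
  coupling keeps mass \<open>min (\<alpha>(F)) (\<beta>(F))\<close> inside each cell \<open>F\<close> of \<^emph>\<open>all\<close> levels at once
  (\<open>hierarchical_coupling\<close>). Hence the mass that is split at level \<open>l\<close>, that is,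
  moved between two different cells of that level, is half of the total discrepancy
  \<open>\<Sum>F. |\<alpha>(F) - \<beta>(F)|\<close> of the level; and mass that is split without leaving
  its annulus is at most half of the discrepancy of the cells there. Mass that is together at level \<open>l - 1\<close> but split at
  level \<open>l\<close> pays the \<open>p\<close>-th power of a cell diameter \<open>2 a\<^sup>n\<^sup>+\<^sup>1 2\<^sup>1\<^sup>-\<^sup>l\<close>, and mass that changes annulus pays
  at most \<open>max 1 2\<^sup>p\<^sup>-\<^sup>1 (|x|\<^sup>p + |y|\<^sup>p)\<close>. Summation by parts over the levels bounds the
  transport cost by weighted cell discrepancies (\<open>transport_cost_le_cell_discrepancies\<close>).

  For a sample of size \<open>N\<close>, the mean of \<open>|\<mu>\<^sub>N(F) - \<mu>(F)|\<close> is at most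
  \<open>min (2 \<mu>(F)) (sqrt (\<mu>(F) / N))\<close>. By the Cauchy-Schwarz inequality, summing over the cells of one annulus
  \<open>B\<close> at level \<open>l\<close> gives \<open>min (2 \<mu>(B)) (sqrt (2\<^sup>d\<^sup>l \<mu>(B) / N))\<close> (\<open>expected_cell_discrepancy_le\<close>), and
  \<open>\<mu>(B) \<le> M\<^sub>q a\<^sup>-\<^sup>q\<^sup>n\<close> by Markov's inequality.

  In the sum over \<open>n\<close> of \<open>a\<^sup>p\<^sup>(\<^sup>n\<^sup>+\<^sup>1\<^sup>)\<close> times this minimum, the first bound is summable at
  \<open>+\<infinity>\<close> because \<open>p < q\<close>, the second one at \<open>-\<infinity>\<close> because \<open>q < 2 p\<close>. Switching from one to the other where
  they agree produces the rate \<open>N\<close> to the power \<open>-(q - p) / q\<close>, the factor \<open>2\<^sup>d\<^sup>l\<^sup>(\<^sup>q\<^sup>-\<^sup>p\<^sup>)\<^sup>/\<^sup>q\<close> and the constant \<open>zeta_fun p q a\<close>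
  (\<open>two_sided_geometric_sum_le\<close>). Together with the weight \<open>2\<^sup>-\<^sup>p\<^sup>l\<close> of level \<open>l\<close> this is geometric in \<open>l\<close>
  with ratio \<open>2\<close> to the power \<open>d - p - d p / q\<close>, less than \<open>1\<close> under the assumptions on \<open>q\<close>. Level \<open>0\<close>
  contributes the summand with \<open>eps_const p\<close>; for the levels \<open>l \<ge> 1\<close> the base
  \<open>2\<^sup>d\<^sup>/\<^sup>2\<^sup>-\<^sup>1\<close> appears, which is below \<open>2\<^sup>d\<^sup>-\<^sup>1 / (2\<^sup>d\<^sup>/\<^sup>2 - 1)\<close>.
\<close>

section \<open>Couplings adapted to nested partitions\<close>

text \<open>
  Partial couplings are represented by a density with respect to the product measure: sums of such
  couplings are then sums of functions, and the mass of \<open>M1\<close> still to be matched has the density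
  \<open>1 - (\<integral> H (x, y) dM2 y)\<close>. The bounds are required at every point, not just almost
  everywhere, which keeps these remainders nonnegative pointwise.
\<close>

definition subcoupling_density :: "'a measure \<Rightarrow> 'b measure \<Rightarrow> ('a \<times> 'b \<Rightarrow> ennreal) \<Rightarrow> bool" where
  "subcoupling_density M1 M2 H \<longleftrightarrow>
     H \<in> borel_measurable (M1 \<Otimes>\<^sub>M M2) \<and>
     (\<forall>x\<in>space M1. (\<integral>\<^sup>+ y. H (x, y) \<partial>M2) \<le> 1) \<and>
     (\<forall>y\<in>space M2. (\<integral>\<^sup>+ x. H (x, y) \<partial>M1) \<le> 1)"

lemma ennreal_inverse_max_mult:
  fixes A B :: ennreal
  assumes "A \<noteq> \<top>" "B \<noteq> \<top>"
  shows "A * (B * inverse (max A B)) = min A B" "B * inverse (max A B) \<le> 1"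
    "A * inverse (max A B) \<le> 1"
proof -
  have cancel: "a * inverse a = 1" if "a \<noteq> 0" "a \<noteq> \<top>" for a :: ennreal
    using ennreal_divide_self[of a] that
    by (simp add: divide_ennreal_def top.not_eq_extremum zero_less_iff_neq_zero)
  have le1: "b * inverse a \<le> 1" if "b \<le> a" "a \<noteq> \<top>" for a b :: ennreal
  proof (cases "a = 0")
    case False
    then have "b * inverse a \<le> a * inverse a"
      using that by (intro mult_right_mono) auto
    then show ?thesis using cancel that False by simp
  qed (use that in auto)
  show "B * inverse (max A B) \<le> 1" "A * inverse (max A B) \<le> 1"
    using assms by (auto intro!: le1 simp: max_def)
  show "A * (B * inverse (max A B)) = min A B"
  proof (cases "max A B = 0")
    case True
    then have "A = 0" "B = 0" by (auto simp: max_def split: if_splits)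
    then show ?thesis by simp
  next
    case False
    then show ?thesis
      using assms cancel[of A] cancel[of B]
      by (auto simp: max_def min_def mult.left_commute[of B A "inverse B"]
          mult.left_commute[of A B "inverse A"] split: if_splits)
  qed
qed

text \<open>
  One greedy step. Let \<open>A\<close>, \<open>B\<close> be the unmatched masses of \<open>M1\<close>, \<open>M2\<close> in a cell. Adding the product of the
  two remainders divided by \<open>max A B\<close> matches the mass \<open>A B / max A B = min A B\<close> and exceeds
  neither marginal. The mass \<open>m\<close> matched before lies within single cells, so it accounts for the difference
  between \<open>A\<close> (or \<open>B\<close>) and the full mass of the cell on both sides, and \<open>m + min A B\<close> is the minimum of the
  full masses.
\<close>

lemma (in pair_prob_space) greedy_step:
  fixes c :: "'a \<Rightarrow> 'i :: countable" and e :: "'b \<Rightarrow> 'i"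
  assumes H: "subcoupling_density M1 M2 H"
    and c [measurable]: "c \<in> measurable M1 (count_space UNIV)"
    and e [measurable]: "e \<in> measurable M2 (count_space UNIV)"
    and supp: "\<And>x y. H (x, y) \<noteq> 0 \<Longrightarrow> c x = e y"
  obtains H' where "subcoupling_density M1 M2 H'" "\<And>z. H z \<le> H' z"
    "\<And>x y. H' (x, y) \<noteq> 0 \<Longrightarrow> c x = e y"
    "\<And>i. min (emeasure M1 {x \<in> space M1. c x = i}) (emeasure M2 {y \<in> space M2. e y = i})
       \<le> (\<integral>\<^sup>+ z. H' z * indicator {z. c (fst z) = i \<and> e (snd z) = i} z \<partial>(M1 \<Otimes>\<^sub>M M2))"
proof -
  have [measurable]: "H \<in> borel_measurable (M1 \<Otimes>\<^sub>M M2)"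
    and H1: "\<And>x. x \<in> space M1 \<Longrightarrow> (\<integral>\<^sup>+ y. H (x, y) \<partial>M2) \<le> 1"
    and H2: "\<And>y. y \<in> space M2 \<Longrightarrow> (\<integral>\<^sup>+ x. H (x, y) \<partial>M1) \<le> 1"
    using H by (auto simp: subcoupling_density_def)
  define \<kappa> where "\<kappa> x = (\<integral>\<^sup>+ y. H (x, y) \<partial>M2)" for x
  define \<eta> where "\<eta> y = (\<integral>\<^sup>+ x. H (x, y) \<partial>M1)" for y
  have [measurable]: "\<kappa> \<in> borel_measurable M1" "\<eta> \<in> borel_measurable M2"
    unfolding \<kappa>_def \<eta>_def by measurable
  define A where "A i = (\<integral>\<^sup>+ x. (1 - \<kappa> x) * indicator {x \<in> space M1. c x = i} x \<partial>M1)" for i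
  define B where "B i = (\<integral>\<^sup>+ y. (1 - \<eta> y) * indicator {y \<in> space M2. e y = i} y \<partial>M2)" for i
  have A: "A i + (\<integral>\<^sup>+ x. \<kappa> x * indicator {x \<in> space M1. c x = i} x \<partial>M1) = emeasure M1 {x \<in> space M1. c x = i}" for i
  proof -
    have "A i + (\<integral>\<^sup>+ x. \<kappa> x * indicator {x \<in> space M1. c x = i} x \<partial>M1)
      = (\<integral>\<^sup>+ x. indicator {x \<in> space M1. c x = i} x \<partial>M1)"
      unfolding A_def
      by (subst nn_integral_add[symmetric])
         (measurable, intro nn_integral_cong,
          use H1 in \<open>auto simp: \<kappa>_def diff_add_cancel_ennreal split: split_indicator\<close>)
    then show ?thesis by simp
  qed
  have B: "B i + (\<integral>\<^sup>+ y. \<eta> y * indicator {y \<in> space M2. e y = i} y \<partial>M2) = emeasure M2 {y \<in> space M2. e y = i}" for i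
  proof -
    have "B i + (\<integral>\<^sup>+ y. \<eta> y * indicator {y \<in> space M2. e y = i} y \<partial>M2)
      = (\<integral>\<^sup>+ y. indicator {y \<in> space M2. e y = i} y \<partial>M2)"
      unfolding B_def
      by (subst nn_integral_add[symmetric])
         (measurable, intro nn_integral_cong,
          use H2 in \<open>auto simp: \<eta>_def diff_add_cancel_ennreal split: split_indicator\<close>)
    then show ?thesis by simp
  qed
  have fin: "A i \<noteq> \<top>" "B i \<noteq> \<top>" for i
  proof -
    have "A i \<le> emeasure M1 {x \<in> space M1. c x = i}" "B i \<le> emeasure M2 {y \<in> space M2. e y = i}"
      by (simp_all flip: A[of i] B[of i])
    then show "A i \<noteq> \<top>" "B i \<noteq> \<top>"
      using M1.emeasure_finite M2.emeasure_finite by (metis neq_top_trans infinity_ennreal_def)+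
  qed
  \<comment> \<open>If nothing is left to match in a cell, \<open>w i = \<infinity>\<close>, but it enters the integrals only through products with \<open>A i = 0\<close> or \<open>B i = 0\<close>.\<close>
  define w where "w i = inverse (max (A i) (B i))" for i
  have Aw: "A i * w i \<le> 1" and Bw: "B i * w i \<le> 1" and ABw: "A i * (B i * w i) = min (A i) (B i)" for i
    using ennreal_inverse_max_mult[OF fin, of i i] by (auto simp: w_def)
  define h where "h = (\<lambda>(x, y). if c x = e y then (1 - \<kappa> x) * (1 - \<eta> y) * w (c x) else 0)"
  have [measurable]: "w \<in> borel_measurable (count_space UNIV)" by simp
  have [measurable]: "h \<in> borel_measurable (M1 \<Otimes>\<^sub>M M2)"
    unfolding h_def by measurable
  have h1: "(\<integral>\<^sup>+ y. h (x, y) \<partial>M2) = (1 - \<kappa> x) * (B (c x) * w (c x))" if "x \<in> space M1" for x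
  proof -
    have "(\<integral>\<^sup>+ y. h (x, y) \<partial>M2) = (\<integral>\<^sup>+ y. ((1 - \<kappa> x) * w (c x)) * ((1 - \<eta> y) * indicator {y \<in> space M2. e y = c x} y) \<partial>M2)"
      by (intro nn_integral_cong) (auto simp: h_def indicator_def mult_ac)
    also have "\<dots> = (1 - \<kappa> x) * w (c x) * B (c x)"
      unfolding B_def by (rule nn_integral_cmult) measurable
    finally show ?thesis by (simp add: mult_ac)
  qed
  have h2: "(\<integral>\<^sup>+ x. h (x, y) \<partial>M1) = (1 - \<eta> y) * (A (e y) * w (e y))" if "y \<in> space M2" for y
  proof -
    have "(\<integral>\<^sup>+ x. h (x, y) \<partial>M1) = (\<integral>\<^sup>+ x. ((1 - \<eta> y) * w (e y)) * ((1 - \<kappa> x) * indicator {x \<in> space M1. c x = e y} x) \<partial>M1)"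
      by (intro nn_integral_cong) (auto simp: h_def indicator_def mult_ac)
    also have "\<dots> = (1 - \<eta> y) * w (e y) * A (e y)"
      unfolding A_def by (rule nn_integral_cmult) measurable
    finally show ?thesis by (simp add: mult_ac)
  qed
  let ?H = "\<lambda>z. H z + h z"
  show ?thesis
  proof (rule that[of ?H])
    show "subcoupling_density M1 M2 ?H"
      unfolding subcoupling_density_def
    proof (intro conjI ballI)
      show "?H \<in> borel_measurable (M1 \<Otimes>\<^sub>M M2)" by measurable
    next
      fix x assume x: "x \<in> space M1"
      then have "(\<integral>\<^sup>+ y. ?H (x, y) \<partial>M2) = \<kappa> x + (1 - \<kappa> x) * (B (c x) * w (c x))"
        by (subst nn_integral_add) (auto simp: h1 \<kappa>_def)
      also have "\<dots> \<le> \<kappa> x + (1 - \<kappa> x) * 1"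
        by (intro add_left_mono mult_left_mono Bw) auto
      also have "\<dots> = 1" using H1[OF x] by (simp add: \<kappa>_def add_diff_inverse_ennreal)
      finally show "(\<integral>\<^sup>+ y. ?H (x, y) \<partial>M2) \<le> 1" .
    next
      fix y assume y: "y \<in> space M2"
      then have "(\<integral>\<^sup>+ x. ?H (x, y) \<partial>M1) = \<eta> y + (1 - \<eta> y) * (A (e y) * w (e y))"
        by (subst nn_integral_add) (auto simp: h2 \<eta>_def)
      also have "\<dots> \<le> \<eta> y + (1 - \<eta> y) * 1"
        by (intro add_left_mono mult_left_mono Aw) auto
      also have "\<dots> = 1" using H2[OF y] by (simp add: \<eta>_def add_diff_inverse_ennreal)
      finally show "(\<integral>\<^sup>+ x. ?H (x, y) \<partial>M1) \<le> 1" .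
    qed
    show "c x = e y" if "?H (x, y) \<noteq> 0" for x y
      using that supp by (auto simp: h_def split: if_splits)
    show "min (emeasure M1 {x \<in> space M1. c x = i}) (emeasure M2 {y \<in> space M2. e y = i})
       \<le> (\<integral>\<^sup>+ z. ?H z * indicator {z. c (fst z) = i \<and> e (snd z) = i} z \<partial>(M1 \<Otimes>\<^sub>M M2))" for i
    proof -
      let ?I = "indicator {z. c (fst z) = i \<and> e (snd z) = i} :: 'a \<times> 'b \<Rightarrow> ennreal"
      let ?IH = "\<integral>\<^sup>+ z. H z * ?I z \<partial>(M1 \<Otimes>\<^sub>M M2)"
      have [measurable]: "?I \<in> borel_measurable (M1 \<Otimes>\<^sub>M M2)"
        unfolding indicator_def by measurable
      have IH1: "?IH = (\<integral>\<^sup>+ x. \<kappa> x * indicator {x \<in> space M1. c x = i} x \<partial>M1)"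
      proof -
        have "?IH = (\<integral>\<^sup>+ x. \<integral>\<^sup>+ y. H (x, y) * ?I (x, y) \<partial>M2 \<partial>M1)"
          by (subst M2.nn_integral_fst[symmetric]) auto
        also have "\<dots> = (\<integral>\<^sup>+ x. \<integral>\<^sup>+ y. H (x, y) * indicator {x \<in> space M1. c x = i} x \<partial>M2 \<partial>M1)"
          using supp by (intro nn_integral_cong) (force simp: indicator_def)
        also have "\<dots> = (\<integral>\<^sup>+ x. \<kappa> x * indicator {x \<in> space M1. c x = i} x \<partial>M1)"
          unfolding \<kappa>_def by (intro nn_integral_cong nn_integral_multc) measurable
        finally show ?thesis .
      qed
      have IH2: "?IH = (\<integral>\<^sup>+ y. \<eta> y * indicator {y \<in> space M2. e y = i} y \<partial>M2)"
      proof -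
        have "?IH = (\<integral>\<^sup>+ y. \<integral>\<^sup>+ x. H (x, y) * ?I (x, y) \<partial>M1 \<partial>M2)"
          by (subst nn_integral_snd[symmetric]) auto
        also have "\<dots> = (\<integral>\<^sup>+ y. \<integral>\<^sup>+ x. H (x, y) * indicator {y \<in> space M2. e y = i} y \<partial>M1 \<partial>M2)"
          using supp by (intro nn_integral_cong) (force simp: indicator_def)
        also have "\<dots> = (\<integral>\<^sup>+ y. \<eta> y * indicator {y \<in> space M2. e y = i} y \<partial>M2)"
          unfolding \<eta>_def by (intro nn_integral_cong nn_integral_multc) measurable
        finally show ?thesis .
      qed
      have Ih: "(\<integral>\<^sup>+ z. h z * ?I z \<partial>(M1 \<Otimes>\<^sub>M M2)) = min (A i) (B i)"
      proof -
        have "(\<integral>\<^sup>+ z. h z * ?I z \<partial>(M1 \<Otimes>\<^sub>M M2)) = (\<integral>\<^sup>+ x. \<integral>\<^sup>+ y. h (x, y) * ?I (x, y) \<partial>M2 \<partial>M1)"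
          by (subst M2.nn_integral_fst[symmetric]) auto
        also have "\<dots> = (\<integral>\<^sup>+ x. \<integral>\<^sup>+ y. h (x, y) * indicator {x \<in> space M1. c x = i} x \<partial>M2 \<partial>M1)"
          by (intro nn_integral_cong) (auto simp: indicator_def h_def)
        also have "\<dots> = (\<integral>\<^sup>+ x. (\<integral>\<^sup>+ y. h (x, y) \<partial>M2) * indicator {x \<in> space M1. c x = i} x \<partial>M1)"
          by (intro nn_integral_cong nn_integral_multc) measurable
        also have "\<dots> = (\<integral>\<^sup>+ x. ((1 - \<kappa> x) * indicator {x \<in> space M1. c x = i} x) * (B i * w i) \<partial>M1)"
          by (intro nn_integral_cong) (auto simp: h1 indicator_def)
        also have "\<dots> = A i * (B i * w i)"
          unfolding A_def by (rule nn_integral_multc) measurable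
        finally show ?thesis by (simp add: ABw)
      qed
      have "min (A i + ?IH) (B i + ?IH) = min (A i) (B i) + ?IH"
        by (auto simp: min_def intro: antisym add_right_mono)
      then have "min (emeasure M1 {x \<in> space M1. c x = i}) (emeasure M2 {y \<in> space M2. e y = i})
        = min (A i) (B i) + ?IH"
        using A[of i] B[of i] IH1 IH2 by simp
      also have "\<dots> = (\<integral>\<^sup>+ z. ?H z * ?I z \<partial>(M1 \<Otimes>\<^sub>M M2))"
        unfolding Ih[symmetric] by (subst nn_integral_add[symmetric]) (auto simp: distrib_right add.commute)
      finally show ?thesis by simp
    qed
  qed auto
qed

text \<open>
  Since the greedy step only adds mass, the optimality reached on the finer partitions survives
  all later steps. Here the partitions get coarser as the index grows.
\<close>

lemma (in pair_prob_space) hierarchical_subcoupling: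
  fixes c :: "nat \<Rightarrow> 'a \<Rightarrow> 'i :: countable" and e :: "nat \<Rightarrow> 'b \<Rightarrow> 'i"
  assumes [measurable]: "\<And>k. c k \<in> measurable M1 (count_space UNIV)"
      "\<And>k. e k \<in> measurable M2 (count_space UNIV)"
    and coarser: "\<And>k x y. c k x = e k y \<Longrightarrow> c (Suc k) x = e (Suc k) y"
  shows "\<exists>H. subcoupling_density M1 M2 H \<and> (\<forall>x y. H (x, y) \<noteq> 0 \<longrightarrow> c K x = e K y) \<and>
    (\<forall>k\<le>K. \<forall>i. min (emeasure M1 {x \<in> space M1. c k x = i}) (emeasure M2 {y \<in> space M2. e k y = i})
       \<le> (\<integral>\<^sup>+ z. H z * indicator {z. c k (fst z) = i \<and> e k (snd z) = i} z \<partial>(M1 \<Otimes>\<^sub>M M2)))"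
proof (induction K)
  case 0
  have zero: "subcoupling_density M1 M2 (\<lambda>_. 0)" by (simp add: subcoupling_density_def)
  obtain H where "subcoupling_density M1 M2 H" "\<And>x y. H (x, y) \<noteq> 0 \<Longrightarrow> c 0 x = e 0 y"
    "\<And>i. min (emeasure M1 {x \<in> space M1. c 0 x = i}) (emeasure M2 {y \<in> space M2. e 0 y = i})
       \<le> (\<integral>\<^sup>+ z. H z * indicator {z. c 0 (fst z) = i \<and> e 0 (snd z) = i} z \<partial>(M1 \<Otimes>\<^sub>M M2))"
    by (rule greedy_step[OF zero, of "c 0" "e 0"]) (auto simp: assms)
  then show ?case by (intro exI[of _ H]) simp
next
  case (Suc K)
  then obtain H where H: "subcoupling_density M1 M2 H" "\<And>x y. H (x, y) \<noteq> 0 \<Longrightarrow> c K x = e K y"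
    "\<And>k i. k \<le> K \<Longrightarrow> min (emeasure M1 {x \<in> space M1. c k x = i}) (emeasure M2 {y \<in> space M2. e k y = i})
       \<le> (\<integral>\<^sup>+ z. H z * indicator {z. c k (fst z) = i \<and> e k (snd z) = i} z \<partial>(M1 \<Otimes>\<^sub>M M2))"
    by blast
  have coarse: "c (Suc K) x = e (Suc K) y" if "H (x, y) \<noteq> 0" for x y
    using coarser[OF H(2)[OF that]] .
  obtain H' where H': "subcoupling_density M1 M2 H'" "\<And>z. H z \<le> H' z"
    "\<And>x y. H' (x, y) \<noteq> 0 \<Longrightarrow> c (Suc K) x = e (Suc K) y"
    "\<And>i. min (emeasure M1 {x \<in> space M1. c (Suc K) x = i}) (emeasure M2 {y \<in> space M2. e (Suc K) y = i})
       \<le> (\<integral>\<^sup>+ z. H' z * indicator {z. c (Suc K) (fst z) = i \<and> e (Suc K) (snd z) = i} z \<partial>(M1 \<Otimes>\<^sub>M M2))"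
    by (rule greedy_step[OF H(1) assms(1)[of "Suc K"] assms(2)[of "Suc K"] coarse]) blast+
  have mono: "min (emeasure M1 {x \<in> space M1. c k x = i}) (emeasure M2 {y \<in> space M2. e k y = i})
       \<le> (\<integral>\<^sup>+ z. H' z * indicator {z. c k (fst z) = i \<and> e k (snd z) = i} z \<partial>(M1 \<Otimes>\<^sub>M M2))" if "k \<le> K" for k i
    by (rule order_trans[OF H(3)[OF that]]) (intro nn_integral_mono mult_right_mono H'(2) zero_le)
  show ?case
  proof (intro exI[of _ H'] conjI allI impI H'(1))
    fix k i assume "k \<le> Suc K"
    then show "min (emeasure M1 {x \<in> space M1. c k x = i}) (emeasure M2 {y \<in> space M2. e k y = i})
       \<le> (\<integral>\<^sup>+ z. H' z * indicator {z. c k (fst z) = i \<and> e k (snd z) = i} z \<partial>(M1 \<Otimes>\<^sub>M M2))"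
      using H'(4)[of i] mono[of k i] by (cases "k = Suc K") simp_all
  qed (rule H'(3))
qed

text \<open>
  A partial coupling of total mass \<open>1\<close> has exact marginals: its marginal densities are at most \<open>1\<close> and
  have integral \<open>1\<close>.
\<close>

lemma (in pair_prob_space) coupling_of_density:
  assumes H: "subcoupling_density M1 M2 H" and mass: "1 \<le> (\<integral>\<^sup>+ z. H z \<partial>(M1 \<Otimes>\<^sub>M M2))"
  shows "prob_space (density (M1 \<Otimes>\<^sub>M M2) H)"
    "distr (density (M1 \<Otimes>\<^sub>M M2) H) M1 fst = M1" "distr (density (M1 \<Otimes>\<^sub>M M2) H) M2 snd = M2"
proof -
  have [measurable]: "H \<in> borel_measurable (M1 \<Otimes>\<^sub>M M2)"
    and H1: "\<And>x. x \<in> space M1 \<Longrightarrow> (\<integral>\<^sup>+ y. H (x, y) \<partial>M2) \<le> 1"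
    and H2: "\<And>y. y \<in> space M2 \<Longrightarrow> (\<integral>\<^sup>+ x. H (x, y) \<partial>M1) \<le> 1"
    using H by (auto simp: subcoupling_density_def)
  have i1: "(\<integral>\<^sup>+ x. \<integral>\<^sup>+ y. H (x, y) \<partial>M2 \<partial>M1) = (\<integral>\<^sup>+ z. H z \<partial>(M1 \<Otimes>\<^sub>M M2))"
    by (rule M2.nn_integral_fst) measurable
  have i2: "(\<integral>\<^sup>+ y. \<integral>\<^sup>+ x. H (x, y) \<partial>M1 \<partial>M2) = (\<integral>\<^sup>+ z. H z \<partial>(M1 \<Otimes>\<^sub>M M2))"
    by (rule nn_integral_snd) measurable
  have "(\<integral>\<^sup>+ x. \<integral>\<^sup>+ y. H (x, y) \<partial>M2 \<partial>M1) \<le> (\<integral>\<^sup>+ x. 1 \<partial>M1)"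
    by (intro nn_integral_mono H1)
  then have mass1: "(\<integral>\<^sup>+ z. H z \<partial>(M1 \<Otimes>\<^sub>M M2)) = 1"
    using mass i1 by (simp add: M1.emeasure_space_1)
  have ae: "AE x in N. f x = 1"
    if N: "prob_space N" and [measurable]: "f \<in> borel_measurable N" and le: "\<And>x. x \<in> space N \<Longrightarrow> f x \<le> 1"
      and int: "(\<integral>\<^sup>+ x. f x \<partial>N) = 1" for N :: "'c measure" and f :: "'c \<Rightarrow> ennreal"
  proof -
    interpret N: prob_space N by fact
    have "(\<integral>\<^sup>+ x. 1 - f x \<partial>N) = (\<integral>\<^sup>+ x. 1 \<partial>N) - (\<integral>\<^sup>+ x. f x \<partial>N)"
      using le int by (intro nn_integral_diff) auto
    also have "\<dots> = 0" using int by (simp add: N.emeasure_space_1)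
    finally have "AE x in N. 1 - f x = 0" by (subst (asm) nn_integral_0_iff_AE) auto
    then show ?thesis
      by (rule AE_mp) (auto intro!: AE_I2 antisym[OF le] simp: diff_eq_0_iff_ennreal)
  qed
  have ae1: "AE x in M1. (\<integral>\<^sup>+ y. H (x, y) \<partial>M2) = 1"
    by (rule ae[OF M1.prob_space_axioms]) (auto simp: H1 i1 mass1)
  have ae2: "AE y in M2. (\<integral>\<^sup>+ x. H (x, y) \<partial>M1) = 1"
    by (rule ae[OF M2.prob_space_axioms]) (auto simp: H2 i2 mass1)
  show "prob_space (density (M1 \<Otimes>\<^sub>M M2) H)"
    by (rule prob_spaceI) (auto simp: emeasure_density mass1 cong: nn_integral_cong)
  show "distr (density (M1 \<Otimes>\<^sub>M M2) H) M1 fst = M1"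
  proof (rule measure_eqI)
    fix A assume "A \<in> sets (distr (density (M1 \<Otimes>\<^sub>M M2) H) M1 fst)"
    then have [measurable]: "A \<in> sets M1" by simp
    have "emeasure (distr (density (M1 \<Otimes>\<^sub>M M2) H) M1 fst) A
      = (\<integral>\<^sup>+ z. H z * indicator A (fst z) \<partial>(M1 \<Otimes>\<^sub>M M2))"
      by (subst emeasure_distr)
         (auto simp: emeasure_density indicator_def intro!: nn_integral_cong)
    also have "\<dots> = (\<integral>\<^sup>+ x. \<integral>\<^sup>+ y. H (x, y) * indicator A x \<partial>M2 \<partial>M1)"
      by (subst M2.nn_integral_fst[symmetric]) auto
    also have "\<dots> = (\<integral>\<^sup>+ x. (\<integral>\<^sup>+ y. H (x, y) \<partial>M2) * indicator A x \<partial>M1)"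
      by (intro nn_integral_cong nn_integral_multc) measurable
    also have "\<dots> = (\<integral>\<^sup>+ x. indicator A x \<partial>M1)"
      using ae1 by (intro nn_integral_cong_AE) auto
    finally show "emeasure (distr (density (M1 \<Otimes>\<^sub>M M2) H) M1 fst) A = emeasure M1 A" by simp
  qed simp
  show "distr (density (M1 \<Otimes>\<^sub>M M2) H) M2 snd = M2"
  proof (rule measure_eqI)
    fix A assume "A \<in> sets (distr (density (M1 \<Otimes>\<^sub>M M2) H) M2 snd)"
    then have [measurable]: "A \<in> sets M2" by simp
    have "emeasure (distr (density (M1 \<Otimes>\<^sub>M M2) H) M2 snd) A
      = (\<integral>\<^sup>+ z. H z * indicator A (snd z) \<partial>(M1 \<Otimes>\<^sub>M M2))"
      by (subst emeasure_distr)
         (auto simp: emeasure_density indicator_def intro!: nn_integral_cong)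
    also have "\<dots> = (\<integral>\<^sup>+ y. \<integral>\<^sup>+ x. H (x, y) * indicator A y \<partial>M1 \<partial>M2)"
      by (subst nn_integral_snd[symmetric]) auto
    also have "\<dots> = (\<integral>\<^sup>+ y. (\<integral>\<^sup>+ x. H (x, y) \<partial>M1) * indicator A y \<partial>M2)"
      by (intro nn_integral_cong nn_integral_multc) measurable
    also have "\<dots> = (\<integral>\<^sup>+ y. indicator A y \<partial>M2)"
      using ae2 by (intro nn_integral_cong_AE) auto
    finally show "emeasure (distr (density (M1 \<Otimes>\<^sub>M M2) H) M2 snd) A = emeasure M2 A" by simp
  qed simp
qed

text \<open>
  The levels \<open>L, L - 1, \<dots>, 0\<close> are treated in this order, followed by the trivial
  partition into a single cell, where the greedy step matches all the remaining mass.
\<close>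

lemma hierarchical_coupling:
  fixes \<alpha> \<beta> :: "(real ^ 'n) measure" and c :: "nat \<Rightarrow> real ^ 'n \<Rightarrow> 'i :: countable"
  assumes "prob_space \<alpha>" "sets \<alpha> = sets borel" "prob_space \<beta>" "sets \<beta> = sets borel"
    and c [measurable]: "\<And>l. c l \<in> measurable borel (count_space UNIV)"
    and finer: "\<And>l x y. c (Suc l) x = c (Suc l) y \<Longrightarrow> c l x = c l y"
  obtains \<xi> where "\<xi> \<in> couplings \<alpha> \<beta>"
    "\<And>l i. l \<le> L \<Longrightarrow> min (emeasure \<alpha> {x. c l x = i}) (emeasure \<beta> {x. c l x = i})
       \<le> emeasure \<xi> {(x, y). c l x = i \<and> c l y = i}"
proof -
  note [measurable_cong] = assms(2,4)
  interpret \<alpha>: prob_space \<alpha> by fact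
  interpret \<beta>: prob_space \<beta> by fact
  interpret pair_prob_space \<alpha> \<beta> ..
  have sp [simp]: "space \<alpha> = UNIV" "space \<beta> = UNIV"
    using assms(2,4)[THEN sets_eq_imp_space_eq] by simp_all
  \<comment> \<open>From index \<open>L + 1\<close> on, all points share one cell, with an arbitrary label.\<close>
  define c' where "c' k = (if k \<le> L then c (L - k) else (\<lambda>_. undefined))" for k
  have [measurable]: "c' k \<in> measurable borel (count_space UNIV)" for k
    by (simp add: c'_def)
  have coarser: "c' (Suc k) x = c' (Suc k) y" if "c' k x = c' k y" for k x y
    using that finer[of "L - Suc k" x y] by (auto simp: c'_def Suc_diff_Suc split: if_splits)
  have m: "c' k \<in> measurable \<alpha> (count_space UNIV)" "c' k \<in> measurable \<beta> (count_space UNIV)" for k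
    by measurable
  obtain H where H: "subcoupling_density \<alpha> \<beta> H"
    "\<And>k i. k \<le> Suc L \<Longrightarrow> min (emeasure \<alpha> {x. c' k x = i}) (emeasure \<beta> {y. c' k y = i})
       \<le> (\<integral>\<^sup>+ z. H z * indicator {z. c' k (fst z) = i \<and> c' k (snd z) = i} z \<partial>(\<alpha> \<Otimes>\<^sub>M \<beta>))"
    using hierarchical_subcoupling[of c' c' "Suc L", OF m coarser] by (simp only: sp) auto
  have [measurable]: "H \<in> borel_measurable (\<alpha> \<Otimes>\<^sub>M \<beta>)"
    using H(1) by (simp add: subcoupling_density_def)
  have mass: "1 \<le> (\<integral>\<^sup>+ z. H z \<partial>(\<alpha> \<Otimes>\<^sub>M \<beta>))"
    using H(2)[of "Suc L" undefined] \<alpha>.emeasure_space_1 \<beta>.emeasure_space_1 by (simp add: c'_def)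
  let ?\<xi> = "density (\<alpha> \<Otimes>\<^sub>M \<beta>) H"
  show ?thesis
  proof (rule that[of ?\<xi>])
    have s: "sets (\<alpha> \<Otimes>\<^sub>M \<beta>) = sets (borel \<Otimes>\<^sub>M borel)"
      by (intro sets_pair_measure_cong assms)
    have d: "distr ?\<xi> borel fst = distr ?\<xi> \<alpha> fst" "distr ?\<xi> borel snd = distr ?\<xi> \<beta> snd"
      using assms(2,4) by (auto intro!: distr_cong)
    show "?\<xi> \<in> couplings \<alpha> \<beta>"
      unfolding couplings_def mem_Collect_eq d using coupling_of_density[OF H(1) mass] s by simp
    fix l i assume l: "l \<le> L"
    have [measurable]: "{z. c l (fst z) = i \<and> c l (snd z) = i} \<in> sets (\<alpha> \<Otimes>\<^sub>M \<beta>)"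
    proof -
      have "{z \<in> space (\<alpha> \<Otimes>\<^sub>M \<beta>). c l (fst z) = i \<and> c l (snd z) = i} \<in> sets (\<alpha> \<Otimes>\<^sub>M \<beta>)"
        by measurable
      then show ?thesis by (simp add: space_pair_measure)
    qed
    have "c' (L - l) = c l" using l by (simp add: c'_def)
    then have "min (emeasure \<alpha> {x. c l x = i}) (emeasure \<beta> {y. c l y = i})
       \<le> (\<integral>\<^sup>+ z. H z * indicator {z. c l (fst z) = i \<and> c l (snd z) = i} z \<partial>(\<alpha> \<Otimes>\<^sub>M \<beta>))"
      using H(2)[of "L - l" i] by simp
    also have "\<dots> = emeasure ?\<xi> {z. c l (fst z) = i \<and> c l (snd z) = i}"
      by (subst emeasure_density) auto
    also have "{z. c l (fst z) = i \<and> c l (snd z) = i} = {(x, y). c l x = i \<and> c l y = i}" by auto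
    finally show "min (emeasure \<alpha> {x. c l x = i}) (emeasure \<beta> {x. c l x = i})
       \<le> emeasure ?\<xi> {(x, y). c l x = i \<and> c l y = i}" .
  qed
qed

section \<open>Transport cost controlled by cell discrepancies\<close>

text \<open>
  The sum of \<open>\<phi> i * |\<alpha>(F i) - \<beta>(F i)|\<close> over the cells \<open>F i\<close> of \<open>c\<close>; the truncated differences of
  extended nonnegative numbers are the positive and the negative part.
\<close>

definition cell_discrepancy ::
  "('i \<Rightarrow> ennreal) \<Rightarrow> ('a \<Rightarrow> 'i) \<Rightarrow> 'a measure \<Rightarrow> 'a measure \<Rightarrow> ennreal" where
  "cell_discrepancy \<phi> c \<alpha> \<beta> =
     (\<integral>\<^sup>+ i. \<phi> i * ((emeasure \<alpha> {x. c x = i} - emeasure \<beta> {x. c x = i})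
        + (emeasure \<beta> {x. c x = i} - emeasure \<alpha> {x. c x = i})) \<partial>count_space UNIV)"

lemma ennreal_diff_min:
  fixes a b :: ennreal
  assumes "a \<noteq> \<top>"
  shows "a - min a b = a - b"
  using assms by (auto simp: min_def diff_eq_0_ennreal top.not_eq_extremum ennreal_minus_eq_0)

text \<open>
  Mass that leaves the cell \<open>i\<close> of its starting point is \<open>\<alpha>(i)\<close> minus the mass kept inside, hence at most the
  positive part of \<open>\<alpha>(i) - \<beta>(i)\<close>; mass that arrives from outside is bounded by the negative part. Counting each
  split pair once at either end makes the two parts add up to the absolute value, which is where
  the factor \<open>1 / 2\<close> in the final estimate comes from.
\<close>

lemma coupling_mismatch_le:
  fixes \<alpha> \<beta> :: "(real ^ 'n) measure" and c :: "real ^ 'n \<Rightarrow> 'i :: countable"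
  assumes \<xi>: "\<xi> \<in> couplings \<alpha> \<beta>"
    and c [measurable]: "c \<in> measurable borel (count_space UNIV)"
    and min_le: "\<And>i. min (emeasure \<alpha> {x. c x = i}) (emeasure \<beta> {x. c x = i})
       \<le> emeasure \<xi> {(x, y). c x = i \<and> c y = i}"
  shows "(\<integral>\<^sup>+ (x, y). (\<phi> (c x) + \<phi> (c y)) * indicator {(x, y). c x \<noteq> c y} (x, y) \<partial>\<xi>) \<le> cell_discrepancy \<phi> c \<alpha> \<beta>"
proof -
  have [measurable_cong]: "sets \<xi> = sets (borel \<Otimes>\<^sub>M borel)"
    and m: "distr \<xi> borel fst = \<alpha>" "distr \<xi> borel snd = \<beta>" and "prob_space \<xi>"
    using \<xi> by (auto simp: couplings_def)
  interpret \<xi>: prob_space \<xi> by fact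
  have sp [simp]: "space \<xi> = UNIV"
    using sets_eq_imp_space_eq[of \<xi> "borel \<Otimes>\<^sub>M borel"] \<open>sets \<xi> = _\<close> by (simp add: space_pair_measure)
  have [measurable]: "{x. c x = i} \<in> sets borel" for i
    using measurable_sets[OF c, of "{i}"] by (simp add: vimage_def)
  have [measurable]: "{z. c (fst z) = i \<and> c (snd z) = j} \<in> sets \<xi>" for i j
  proof -
    have "{z \<in> space \<xi>. c (fst z) = i \<and> c (snd z) = j} \<in> sets \<xi>" by measurable
    then show ?thesis by simp
  qed
  have [measurable]: "{z. c (fst z) = i \<and> c (snd z) \<noteq> i} \<in> sets \<xi>"
    "{z. c (fst z) \<noteq> i \<and> c (snd z) = i} \<in> sets \<xi>" for i
  proof -
    have "{z \<in> space \<xi>. c (fst z) = i \<and> c (snd z) \<noteq> i} \<in> sets \<xi>"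
      "{z \<in> space \<xi>. c (fst z) \<noteq> i \<and> c (snd z) = i} \<in> sets \<xi>" by measurable
    then show "{z. c (fst z) = i \<and> c (snd z) \<noteq> i} \<in> sets \<xi>"
      "{z. c (fst z) \<noteq> i \<and> c (snd z) = i} \<in> sets \<xi>" by simp_all
  qed
  have A: "emeasure \<alpha> {x. c x = i} = emeasure \<xi> {z. c (fst z) = i}"
    and B: "emeasure \<beta> {x. c x = i} = emeasure \<xi> {z. c (snd z) = i}" for i
    unfolding m[symmetric] by (subst emeasure_distr; simp add: vimage_def)+
  have both: "{(x, y). c x = i \<and> c y = i} = {z. c (fst z) = i \<and> c (snd z) = i}" for i by auto
  have x: "emeasure \<xi> {z. c (fst z) = i \<and> c (snd z) \<noteq> i} \<le> emeasure \<alpha> {x. c x = i} - emeasure \<beta> {x. c x = i}" for i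
  proof -
    have "emeasure \<xi> {z. c (fst z) = i \<and> c (snd z) \<noteq> i}
      = emeasure \<xi> ({z. c (fst z) = i} - {z. c (fst z) = i \<and> c (snd z) = i})"
      by (rule arg_cong[of _ _ "emeasure \<xi>"]) auto
    also have "\<dots> = emeasure \<xi> {z. c (fst z) = i} - emeasure \<xi> {z. c (fst z) = i \<and> c (snd z) = i}"
    proof (rule emeasure_Diff)
      have "{z \<in> space \<xi>. c (fst z) = i} \<in> sets \<xi>" by measurable
      then show "{z. c (fst z) = i} \<in> sets \<xi>" by simp
    qed auto
    also have "\<dots> \<le> emeasure \<xi> {z. c (fst z) = i} - min (emeasure \<alpha> {x. c x = i}) (emeasure \<beta> {x. c x = i})"
      by (intro ennreal_mono_minus) (use min_le[of i, unfolded both] in simp)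
    finally show ?thesis by (simp add: A ennreal_diff_min)
  qed
  have y: "emeasure \<xi> {z. c (fst z) \<noteq> i \<and> c (snd z) = i} \<le> emeasure \<beta> {x. c x = i} - emeasure \<alpha> {x. c x = i}" for i
  proof -
    have "emeasure \<xi> {z. c (fst z) \<noteq> i \<and> c (snd z) = i}
      = emeasure \<xi> ({z. c (snd z) = i} - {z. c (fst z) = i \<and> c (snd z) = i})"
      by (rule arg_cong[of _ _ "emeasure \<xi>"]) auto
    also have "\<dots> = emeasure \<xi> {z. c (snd z) = i} - emeasure \<xi> {z. c (fst z) = i \<and> c (snd z) = i}"
    proof (rule emeasure_Diff)
      have "{z \<in> space \<xi>. c (snd z) = i} \<in> sets \<xi>" by measurable
      then show "{z. c (snd z) = i} \<in> sets \<xi>" by simp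
    qed auto
    also have "\<dots> \<le> emeasure \<xi> {z. c (snd z) = i} - min (emeasure \<beta> {x. c x = i}) (emeasure \<alpha> {x. c x = i})"
      by (intro ennreal_mono_minus) (use min_le[of i, unfolded both] in \<open>simp add: min.commute\<close>)
    finally show ?thesis by (simp add: B ennreal_diff_min)
  qed
  have "(\<integral>\<^sup>+ (x, y). (\<phi> (c x) + \<phi> (c y)) * indicator {(x, y). c x \<noteq> c y} (x, y) \<partial>\<xi>)
    = (\<integral>\<^sup>+ z. (\<integral>\<^sup>+ i. \<phi> i * (indicator {z. c (fst z) = i \<and> c (snd z) \<noteq> i} z
          + indicator {z. c (fst z) \<noteq> i \<and> c (snd z) = i} z) \<partial>count_space UNIV) \<partial>\<xi>)"
  proof (intro nn_integral_cong, clarify)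
    fix x y
    have "(\<integral>\<^sup>+ i. \<phi> i * (indicator {z. c (fst z) = i \<and> c (snd z) \<noteq> i} (x, y)
          + indicator {z. c (fst z) \<noteq> i \<and> c (snd z) = i} (x, y)) \<partial>count_space UNIV)
      = (\<Sum>i\<in>{c x, c y}. \<phi> i * (indicator {z. c (fst z) = i \<and> c (snd z) \<noteq> i} (x, y)
          + indicator {z. c (fst z) \<noteq> i \<and> c (snd z) = i} (x, y)))"
      by (rule nn_integral_count_space') (auto simp: indicator_def)
    also have "\<dots> = (\<phi> (c x) + \<phi> (c y)) * indicator {(x, y). c x \<noteq> c y} (x, y)"
      by (cases "c x = c y") auto
    finally show "(\<phi> (c x) + \<phi> (c y)) * indicator {(x, y). c x \<noteq> c y} (x, y) =
      (\<integral>\<^sup>+ i. \<phi> i * (indicator {z. c (fst z) = i \<and> c (snd z) \<noteq> i} (x, y)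
          + indicator {z. c (fst z) \<noteq> i \<and> c (snd z) = i} (x, y)) \<partial>count_space UNIV)" ..
  qed
  also have "\<dots> = (\<integral>\<^sup>+ i. \<integral>\<^sup>+ z. \<phi> i * (indicator {z. c (fst z) = i \<and> c (snd z) \<noteq> i} z
          + indicator {z. c (fst z) \<noteq> i \<and> c (snd z) = i} z) \<partial>\<xi> \<partial>count_space UNIV)"
    by (rule nn_integral_count_space_nn_integral) (auto intro: countableI_type)
  also have "\<dots> = (\<integral>\<^sup>+ i. \<phi> i * (emeasure \<xi> {z. c (fst z) = i \<and> c (snd z) \<noteq> i}
        + emeasure \<xi> {z. c (fst z) \<noteq> i \<and> c (snd z) = i}) \<partial>count_space UNIV)"
    by (intro nn_integral_cong) (simp add: nn_integral_cmult nn_integral_add)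
  also have "\<dots> \<le> cell_discrepancy \<phi> c \<alpha> \<beta>"
    unfolding cell_discrepancy_def by (intro nn_integral_mono mult_left_mono add_mono x y) auto
  finally show ?thesis .
qed

text \<open>
  The origin gets the index \<^const>\<open>None\<close>: the value \<open>log a 0 = 0\<close> would put it into a true annulus,
  whose mass could then not be bounded by the moment. Its outer radius \<open>0\<close> makes it contribute
  nothing to weighted sums.
\<close>

definition annulus :: "real \<Rightarrow> real ^ 'n \<Rightarrow> int option" where
  "annulus a x = (if x = 0 then None else Some \<lfloor>log a (infnorm x)\<rfloor>)"

definition outer_radius :: "real \<Rightarrow> int option \<Rightarrow> real" where
  "outer_radius a n = (case n of None \<Rightarrow> 0 | Some m \<Rightarrow> a powr (real_of_int m + 1))"

text \<open>
  The coordinates are rescaled from the interval of radius \<open>outer_radius\<close> to the interval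
  \<open>(0, 1)\<close> and rounded down to multiples of \<open>2\<^sup>-\<^sup>l\<close>. The annuli exclude their outer boundary, so the endpoint
  \<open>1\<close> does not occur and \<open>2\<^sup>l\<close> values per coordinate suffice. At level \<open>0\<close> a cell is a whole annulus. At the
  origin the division by \<open>0\<close> gives \<open>0\<close>, the midpoint.
\<close>

definition cell :: "real \<Rightarrow> nat \<Rightarrow> real ^ 'n \<Rightarrow> int option \<times> ('n \<Rightarrow> int)" where
  "cell a l x = (annulus a x,
     \<lambda>j. \<lfloor>2 ^ l * ((x $ j / outer_radius a (annulus a x) + 1) / 2)\<rfloor>)"

lemma infnorm_less_outer_radius:
  assumes "1 < a" "x \<noteq> 0"
  shows "infnorm x < outer_radius a (annulus a x)"
proof -
  have "log a (infnorm x) < real_of_int \<lfloor>log a (infnorm x)\<rfloor> + 1" by linarith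
  then show ?thesis
    using assms by (subst (asm) log_less_iff) (auto simp: outer_radius_def annulus_def infnorm_pos_lt)
qed

lemma outer_radius_le:
  assumes "1 < a"
  shows "outer_radius a (annulus a x) \<le> a * infnorm x"
proof (cases "x = 0")
  case False
  have "real_of_int \<lfloor>log a (infnorm x)\<rfloor> \<le> log a (infnorm x)" by linarith
  then have "a powr real_of_int \<lfloor>log a (infnorm x)\<rfloor> \<le> infnorm x"
    using False assms by (subst (asm) le_log_iff) (auto simp: infnorm_pos_lt)
  then show ?thesis
    using False assms by (simp add: outer_radius_def annulus_def powr_add mult.commute)
qed (simp add: outer_radius_def annulus_def infnorm_0)

lemma outer_radius_nonneg: "0 \<le> outer_radius a n"
  by (simp add: outer_radius_def split: option.split)

lemma infnorm_le_outer_radius: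
  assumes "1 < a"
  shows "infnorm x \<le> outer_radius a (annulus a x)"
  using infnorm_less_outer_radius[OF assms, of x] by (cases "x = 0") (auto simp: infnorm_0 outer_radius_nonneg)

lemma cell_Suc_eqD:
  assumes "cell a (Suc l) x = cell a (Suc l) y"
  shows "cell a l x = cell a l y"
proof -
  have half: "\<lfloor>2 ^ l * t\<rfloor> = \<lfloor>2 ^ Suc l * t\<rfloor> div 2" for t :: real
    using floor_divide_real_eq_div[of 2 "2 ^ Suc l * t"] by simp
  show ?thesis
    using assms unfolding cell_def half by (auto simp: fun_eq_iff)
qed

lemma cell_coordinate_bounds:
  assumes "1 < a"
  shows "snd (cell a l x) j \<in> {0..<2 ^ l}"
proof -
  let ?r = "outer_radius a (annulus a x)"
  have "-1 < x $ j / ?r \<and> x $ j / ?r < 1"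
  proof (cases "x = 0")
    case False
    then have "\<bar>x $ j\<bar> < ?r"
      using infnorm_less_outer_radius[OF assms, of x] component_le_infnorm_cart[of x j] by simp
    then show ?thesis by (auto simp: field_simps abs_less_iff)
  qed simp
  then have "0 \<le> 2 ^ l * ((x $ j / ?r + 1) / 2)" "2 ^ l * ((x $ j / ?r + 1) / 2) < 2 ^ l"
    by auto
  then show ?thesis by (simp add: cell_def floor_less_iff)
qed

lemma infnorm_diff_le_cell:
  fixes x y :: "real ^ 'n"
  assumes "1 < a" and eq: "cell a l x = cell a l y"
  shows "infnorm (x - y) \<le> 2 * outer_radius a (annulus a y) / 2 ^ l"
proof -
  let ?r = "outer_radius a (annulus a y)"
  have ann: "annulus a x = annulus a y" using eq by (simp add: cell_def)
  show ?thesis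
  proof (cases "y = 0")
    case True
    then have "x = 0" using ann by (simp add: annulus_def split: if_splits)
    with True show ?thesis by (simp add: infnorm_0 outer_radius_nonneg)
  next
    case False
    then have r: "0 < ?r" using assms(1) by (simp add: annulus_def outer_radius_def)
    have "\<bar>(x - y) $ j\<bar> \<le> 2 * ?r / 2 ^ l" for j
    proof -
      define s t where "s = 2 ^ l * ((x $ j / ?r + 1) / 2)" and "t = 2 ^ l * ((y $ j / ?r + 1) / 2)"
      have "\<lfloor>s\<rfloor> = \<lfloor>t\<rfloor>"
        using eq ann unfolding s_def t_def by (simp add: cell_def fun_eq_iff)
      then have "\<bar>s - t\<bar> \<le> 1" by linarith
      moreover have "s - t = (x - y) $ j * 2 ^ l / (2 * ?r)"
        using r by (simp add: s_def t_def field_simps)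
      moreover have "\<bar>(x - y) $ j * 2 ^ l / (2 * ?r)\<bar> = \<bar>(x - y) $ j\<bar> * 2 ^ l / (2 * ?r)"
        using r by (simp only: abs_divide abs_mult) simp
      ultimately have "\<bar>(x - y) $ j\<bar> * 2 ^ l / (2 * ?r) \<le> 1" by simp
      then show ?thesis
        using r by (simp only: pos_divide_le_eq pos_le_divide_eq mult_1_left zero_less_power
            zero_less_mult_iff zero_less_numeral simp_thms)
    qed
    then show ?thesis by (subst infnorm_eq_Max) auto
  qed
qed

lemma measurable_annulus [measurable]:
  "annulus a \<in> measurable borel (count_space UNIV)"
proof -
  have [measurable]: "infnorm \<in> borel_measurable (borel :: (real ^ 'n) measure)"
    by (intro borel_measurable_continuous_onI continuous_on_infnorm continuous_on_id)
  show ?thesis unfolding annulus_def[abs_def] by measurable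
qed

lemma measurable_cell [measurable]:
  "cell a l \<in> measurable borel (count_space UNIV)"
proof (subst measurable_count_space_eq2_countable, intro conjI ballI)
  fix i :: "int option \<times> ('a \<Rightarrow> int)"
  have "{x \<in> space borel. annulus a x = fst i \<and>
      (\<forall>j\<in>UNIV. \<lfloor>2 ^ l * ((x $ j / outer_radius a (fst i) + 1) / 2)\<rfloor> = snd i j)} \<in> sets borel"
    by measurable
  also have "{x \<in> space borel. annulus a x = fst i \<and>
      (\<forall>j\<in>UNIV. \<lfloor>2 ^ l * ((x $ j / outer_radius a (fst i) + 1) / 2)\<rfloor> = snd i j)} = cell a l -` {i} \<inter> space borel"
    by (cases i) (auto simp: cell_def fun_eq_iff)
  finally show "cell a l -` {i} \<inter> space borel \<in> sets borel" .
qed auto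

text \<open>
  Here \<open>2\<^sup>p * eps_const p = max 2\<^sup>p\<^sup>-\<^sup>1 1\<close>: the first value comes from convexity when \<open>p \<ge> 1\<close>, the second from
  subadditivity when \<open>p \<le> 1\<close>.
\<close>

lemma powr_add_le_eps:
  fixes s t :: real
  assumes "0 < p" "0 \<le> s" "0 \<le> t"
  shows "(s + t) powr p \<le> 2 powr p * eps_const p * (s powr p + t powr p)"
proof (cases "s = 0 \<or> t = 0")
  case True
  have "1 \<le> 2 powr p * eps_const p"
    using assms by (simp add: eps_const_def max_mult_distrib_left powr_minus le_max_iff_disj)
  then have "1 * (s powr p + t powr p) \<le> 2 powr p * eps_const p * (s powr p + t powr p)"
    by (intro mult_right_mono) auto
  then show ?thesis using True assms by auto
next
  case False
  then have st: "0 < s" "0 < t" using assms by auto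
  show ?thesis
  proof (cases "p \<ge> 1")
    case True
    have "((1 - 1 / 2) *\<^sub>R s + (1 / 2) *\<^sub>R t) powr p \<le> (1 - 1 / 2) * s powr p + 1 / 2 * t powr p"
      using st by (intro convex_onD[OF powr_convex[OF True]]) auto
    also have "((1 - 1 / 2) *\<^sub>R s + (1 / 2) *\<^sub>R t) powr p = (s + t) powr p / 2 powr p"
      using st by (subst powr_divide[symmetric]) (auto simp: add_divide_distrib)
    finally have "(s + t) powr p \<le> 2 powr p * (1 / 2) * (s powr p + t powr p)"
      by (simp add: field_simps)
    also have "\<dots> \<le> 2 powr p * eps_const p * (s powr p + t powr p)"
      by (intro mult_right_mono mult_left_mono) (auto simp: eps_const_def powr_minus)
    finally show ?thesis .
  next
    case False
    have frac: "u \<le> u powr p" if "0 < u" "u < 1" for u :: real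
      using powr_mono'[of p 1 u] that False by simp
    have "1 = s / (s + t) + t / (s + t)" using st by (simp add: add_divide_distrib[symmetric])
    also have "\<dots> \<le> (s / (s + t)) powr p + (t / (s + t)) powr p"
      using st by (intro add_mono frac) auto
    also have "\<dots> = (s powr p + t powr p) / (s + t) powr p"
      using st by (simp add: powr_divide add_divide_distrib)
    finally have "(s + t) powr p \<le> 1 * (s powr p + t powr p)"
      using st by (simp add: field_simps)
    also have "\<dots> \<le> 2 powr p * eps_const p * (s powr p + t powr p)"
      by (intro mult_right_mono) (auto simp: eps_const_def max_mult_distrib_left powr_minus le_max_iff_disj)
    finally show ?thesis .
  qed
qed

text \<open>
  Two points of one annulus that agree up to level \<open>l < L\<close> but not beyond are at distance at most the diameter
  of a cell of level \<open>l\<close>, whose \<open>p\<close>-th power is proportional to \<open>w l\<close>; the telescoping sum of the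
  \<open>w (k - 1) - w k\<close> over the levels \<open>k = l + 1, \<dots>, L\<close> that separate them, plus \<open>w L\<close>, is exactly \<open>w l\<close>. For
  points in different annuli the summand with \<open>cell a 0\<close> alone dominates.
\<close>

lemma infnorm_powr_le_scales:
  fixes x y :: "real ^ 'n"
  assumes "1 < a" "0 < p"
  defines "\<rho> \<equiv> \<lambda>x :: real ^ 'n. outer_radius a (annulus a x) powr p"
    and "w \<equiv> \<lambda>l. 2 powr (- p * real l)"
  shows "infnorm (x - y) powr p
     \<le> 2 powr p * eps_const p * ((\<rho> x + \<rho> y) * of_bool (cell a 0 x \<noteq> cell a 0 y))
       + 2 powr p * w L * \<rho> y
       + (\<Sum>l=1..L. 2 powr p * (w (l - 1) - w l) / 2 * ((\<rho> x + \<rho> y) * of_bool (cell a l x \<noteq> cell a l y)))"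
proof -
  have w: "w (l - 1) - w l \<ge> 0" for l
    using assms(2) by (simp add: w_def)
  have \<rho>: "\<rho> x \<ge> 0" for x by (simp add: \<rho>_def)
  have sum: "(\<Sum>l=1..L. 2 powr p * (w (l - 1) - w l) / 2 * ((\<rho> x + \<rho> y) * of_bool (cell a l x \<noteq> cell a l y))) \<ge> 0" for L
    using w \<rho> by (intro sum_nonneg mult_nonneg_nonneg divide_nonneg_pos add_nonneg_nonneg) auto
  show ?thesis
  proof (cases "cell a 0 x = cell a 0 y")
    case False
    have "infnorm (x - y) \<le> infnorm x + infnorm y"
      using infnorm_triangle[of x "- y"] by (simp add: infnorm_neg)
    then have "infnorm (x - y) powr p \<le> (infnorm x + infnorm y) powr p"
      using assms by (intro powr_mono2) (auto simp: infnorm_pos_le)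
    also have "\<dots> \<le> 2 powr p * eps_const p * (infnorm x powr p + infnorm y powr p)"
      using assms by (intro powr_add_le_eps) (auto simp: infnorm_pos_le)
    also have "\<dots> \<le> 2 powr p * eps_const p * (\<rho> x + \<rho> y)"
      unfolding \<rho>_def using assms
      by (intro mult_left_mono add_mono powr_mono2 infnorm_le_outer_radius)
         (auto simp: infnorm_pos_le eps_const_def le_max_iff_disj)
    finally have "infnorm (x - y) powr p \<le> 2 powr p * eps_const p * (\<rho> x + \<rho> y)" .
    moreover have "2 powr p * w L * \<rho> y \<ge> 0" using \<rho> by (simp add: w_def)
    ultimately show ?thesis using False sum[of L] by simp
  next
    case True
    then have eq: "\<rho> x = \<rho> y" by (simp add: cell_def \<rho>_def)
    have step: "infnorm (x - y) powr p \<le> 2 powr p * w l * \<rho> y" if "cell a l x = cell a l y" for l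
    proof -
      have "infnorm (x - y) powr p \<le> (2 * outer_radius a (annulus a y) / 2 ^ l) powr p"
        using assms infnorm_diff_le_cell[OF assms(1) that] by (intro powr_mono2) (auto simp: infnorm_pos_le)
      also have "\<dots> = 2 powr p * w l * \<rho> y"
        by (simp add: powr_mult powr_divide outer_radius_nonneg w_def \<rho>_def powr_minus divide_simps
              powr_powr mult.commute flip: powr_realpow)
      finally show ?thesis .
    qed
    have "infnorm (x - y) powr p \<le> 2 powr p * w L * \<rho> y
       + (\<Sum>l=1..L. 2 powr p * (w (l - 1) - w l) / 2 * ((\<rho> x + \<rho> y) * of_bool (cell a l x \<noteq> cell a l y)))"
    proof (induction L)
      case 0
      then show ?case using step[OF True] by simp
    next
      case (Suc L)
      show ?case
      proof (cases "cell a (Suc L) x = cell a (Suc L) y")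
        case True
        then show ?thesis using step[OF True] sum[of "Suc L"] by linarith
      next
        case False
        then have "2 powr p * w (Suc L) * \<rho> y
            + 2 powr p * (w (Suc L - 1) - w (Suc L)) / 2
              * ((\<rho> x + \<rho> y) * of_bool (cell a (Suc L) x \<noteq> cell a (Suc L) y))
          = 2 powr p * w L * \<rho> y"
          by (simp add: eq field_simps)
        then show ?thesis using Suc by simp
      qed
    qed
    then show ?thesis using True by simp
  qed
qed

lemma nn_integral_coupling_snd:
  fixes \<alpha> \<beta> :: "(real ^ 'n) measure"
  assumes "\<xi> \<in> couplings \<alpha> \<beta>" and [measurable]: "f \<in> borel_measurable borel"
  shows "(\<integral>\<^sup>+ z. f (snd z) \<partial>\<xi>) = (\<integral>\<^sup>+ y. f y \<partial>\<beta>)"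
proof -
  have [measurable_cong]: "sets \<xi> = sets (borel \<Otimes>\<^sub>M borel)" and \<beta>: "distr \<xi> borel snd = \<beta>"
    using assms by (auto simp: couplings_def)
  show ?thesis
    unfolding \<beta>[symmetric] by (subst nn_integral_distr) auto
qed

text \<open>
  The level \<open>L\<close> is where the subdivision stops; its summand has the factor \<open>w L\<close> and will vanish as
  \<open>L\<close> grows.
\<close>

lemma transport_cost_le_cell_discrepancies:
  fixes \<alpha> \<beta> :: "(real ^ 'n) measure"
  assumes "1 < a" "0 < p"
    and \<alpha>: "prob_space \<alpha>" "sets \<alpha> = sets borel" and \<beta>: "prob_space \<beta>" "sets \<beta> = sets borel"
  defines "\<phi> \<equiv> \<lambda>i :: int option \<times> ('n \<Rightarrow> int). ennreal (outer_radius a (fst i) powr p)"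
    and "w \<equiv> \<lambda>l. 2 powr (- p * real l)"
  shows "transport_cost p \<alpha> \<beta>
     \<le> ennreal (2 powr p * eps_const p) * cell_discrepancy \<phi> (cell a 0) \<alpha> \<beta>
       + ennreal (2 powr p * w L) * (\<integral>\<^sup>+ y. ennreal (outer_radius a (annulus a y) powr p) \<partial>\<beta>)
       + (\<Sum>l=1..L. ennreal (2 powr p * (w (l - 1) - w l) / 2) * cell_discrepancy \<phi> (cell a l) \<alpha> \<beta>)"
proof -
  obtain \<xi> where \<xi>: "\<xi> \<in> couplings \<alpha> \<beta>"
    and min_le: "\<And>l i. l \<le> L \<Longrightarrow> min (emeasure \<alpha> {x. cell a l x = i}) (emeasure \<beta> {x. cell a l x = i})
       \<le> emeasure \<xi> {(x, y). cell a l x = i \<and> cell a l y = i}"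
    by (rule hierarchical_coupling[OF \<alpha> \<beta>, of "cell a" L])
       (rule measurable_cell, erule cell_Suc_eqD, blast)
  have [measurable_cong]: "sets \<xi> = sets (borel \<Otimes>\<^sub>M borel)"
    using \<xi> by (auto simp: couplings_def)
  define mis where "mis l = (\<lambda>(x, y). (\<phi> (cell a l x) + \<phi> (cell a l y))
     * indicator {(x, y). cell a l x \<noteq> cell a l y} (x, y))" for l
  have [measurable]: "(\<lambda>y :: real ^ 'n. outer_radius a (annulus a y)) \<in> borel_measurable borel"
    by measurable
  have [measurable]: "\<phi> \<in> borel_measurable (count_space UNIV)" by simp
  have [measurable]: "mis l \<in> borel_measurable \<xi>" for l
  proof -
    have [measurable]: "(\<lambda>z. cell a l (fst z)) \<in> measurable \<xi> (count_space UNIV)"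
      "(\<lambda>z. cell a l (snd z)) \<in> measurable \<xi> (count_space UNIV)"
      using measurable_compose[OF measurable_fst measurable_cell]
        measurable_compose[OF measurable_snd measurable_cell] by measurable
    have "mis l = (\<lambda>z. if cell a l (fst z) = cell a l (snd z) then 0 else \<phi> (cell a l (fst z)) + \<phi> (cell a l (snd z)))"
      by (auto simp: mis_def)
    then show ?thesis by simp
  qed
  have w: "w (l - 1) - w l \<ge> 0" for l
    using assms(2) by (simp add: w_def)
  have eps: "eps_const p \<ge> 0" by (simp add: eps_const_def le_max_iff_disj)
  have mis: "(\<integral>\<^sup>+ z. mis l z \<partial>\<xi>) \<le> cell_discrepancy \<phi> (cell a l) \<alpha> \<beta>" if "l \<le> L" for l
    unfolding mis_def using coupling_mismatch_le[OF \<xi> measurable_cell min_le[OF that]] .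
  have "transport_cost p \<alpha> \<beta> \<le> (\<integral>\<^sup>+ (x, y). ennreal (infnorm (x - y) powr p) \<partial>\<xi>)"
    unfolding transport_cost_def by (rule INF_lower[OF \<xi>])
  also have "\<dots> \<le> (\<integral>\<^sup>+ z. ennreal (2 powr p * eps_const p) * mis 0 z
       + ennreal (2 powr p * w L) * ennreal (outer_radius a (annulus a (snd z)) powr p)
       + (\<Sum>l=1..L. ennreal (2 powr p * (w (l - 1) - w l) / 2) * mis l z) \<partial>\<xi>)"
  proof (intro nn_integral_mono, clarify)
    fix x y :: "real ^ 'n"
    let ?\<rho> = "\<lambda>x :: real ^ 'n. outer_radius a (annulus a x) powr p"
    let ?m = "\<lambda>l. (?\<rho> x + ?\<rho> y) * of_bool (cell a l x \<noteq> cell a l y)"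
    have mis': "mis l (x, y) = ennreal (?m l)" for l
      by (simp add: mis_def \<phi>_def cell_def)
    have "ennreal (infnorm (x - y) powr p) \<le> ennreal (2 powr p * eps_const p * ?m 0
       + 2 powr p * w L * ?\<rho> y + (\<Sum>l=1..L. 2 powr p * (w (l - 1) - w l) / 2 * ?m l))"
      unfolding w_def by (intro ennreal_leI infnorm_powr_le_scales assms)
    also have "\<dots> = ennreal (2 powr p * eps_const p) * mis 0 (x, y)
       + ennreal (2 powr p * w L) * ennreal (?\<rho> y)
       + (\<Sum>l=1..L. ennreal (2 powr p * (w (l - 1) - w l) / 2) * mis l (x, y))"
    proof -
      have "0 \<le> 2 powr p * (w (l - 1) - w l) / 2" for l using w by simp
      moreover have "0 \<le> ?m l" for l by simp
      ultimately have "(\<Sum>l=1..L. ennreal (2 powr p * (w (l - 1) - w l) / 2) * mis l (x, y))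
        = ennreal (\<Sum>l=1..L. 2 powr p * (w (l - 1) - w l) / 2 * ?m l)"
        by (simp only: mis' ennreal_mult[symmetric] sum_ennreal mult_nonneg_nonneg)
      moreover have "0 \<le> (\<Sum>l=1..L. 2 powr p * (w (l - 1) - w l) / 2 * ?m l)"
        using w by (intro sum_nonneg mult_nonneg_nonneg divide_nonneg_pos) auto
      moreover have "0 \<le> 2 powr p * w L" by (simp add: w_def)
      ultimately show ?thesis
        using eps by (simp only: mis') (simp add: ennreal_mult del: of_bool_eq_0_iff)
    qed
    finally show "ennreal (infnorm (x - y) powr p) \<le> ennreal (2 powr p * eps_const p) * mis 0 (x, y)
       + ennreal (2 powr p * w L) * ennreal (outer_radius a (annulus a (snd (x, y))) powr p)
       + (\<Sum>l=1..L. ennreal (2 powr p * (w (l - 1) - w l) / 2) * mis l (x, y))"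
      by simp
  qed
  also have "\<dots> = ennreal (2 powr p * eps_const p) * (\<integral>\<^sup>+ z. mis 0 z \<partial>\<xi>)
       + ennreal (2 powr p * w L) * (\<integral>\<^sup>+ z. ennreal (outer_radius a (annulus a (snd z)) powr p) \<partial>\<xi>)
       + (\<Sum>l=1..L. ennreal (2 powr p * (w (l - 1) - w l) / 2) * (\<integral>\<^sup>+ z. mis l z \<partial>\<xi>))"
    by (simp add: nn_integral_add nn_integral_cmult nn_integral_sum)
  also have "(\<integral>\<^sup>+ z. ennreal (outer_radius a (annulus a (snd z)) powr p) \<partial>\<xi>)
      = (\<integral>\<^sup>+ y. ennreal (outer_radius a (annulus a y) powr p) \<partial>\<beta>)"
    by (rule nn_integral_coupling_snd[OF \<xi>, of "\<lambda>y. ennreal (outer_radius a (annulus a y) powr p)"])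
       measurable
  finally show ?thesis
    by (elim order_trans) (intro add_mono mult_left_mono sum_mono mis order_refl; simp)
qed

section \<open>Mean discrepancy of the empirical measure\<close>

lemma ennreal_abs_diff:
  assumes "0 \<le> s" "0 \<le> t"
  shows "(ennreal s - ennreal t) + (ennreal t - ennreal s) = ennreal \<bar>s - t\<bar>"
  using assms by (cases "s \<le> t") (auto simp: ennreal_minus ennreal_neg)

locale iid_sample = prob_space M for M :: "'w measure" +
  fixes X :: "nat \<Rightarrow> 'w \<Rightarrow> real ^ 'n" and \<mu> :: "(real ^ 'n) measure" and N :: nat
  assumes prob_\<mu>: "prob_space \<mu>" and sets_\<mu> [measurable_cong]: "sets \<mu> = sets borel"
    and indep_X: "indep_vars (\<lambda>_. borel) X {1..}"
    and distr_X: "\<And>k. k \<ge> 1 \<Longrightarrow> distr M borel (X k) = \<mu>"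
    and N: "N \<ge> 1"
begin

sublocale \<mu>: prob_space \<mu> by (rule prob_\<mu>)

abbreviation \<mu>\<^sub>N :: "'w \<Rightarrow> (real ^ 'n) measure" where
  "\<mu>\<^sub>N \<omega> \<equiv> empirical_measure N (\<lambda>k. X k \<omega>)"

lemma random_variable_X: "k \<ge> 1 \<Longrightarrow> X k \<in> borel_measurable M"
  using indep_X by (auto simp: indep_vars_def)

lemma emeasure_empirical_real:
  assumes "A \<in> sets borel"
  shows "emeasure (\<mu>\<^sub>N \<omega>) A = ennreal ((\<Sum>k=1..N. indicator A (X k \<omega>)) / real N)"
proof -
  have "(\<Sum>k=1..N. emeasure (return borel (X k \<omega>)) A) = ennreal (\<Sum>k=1..N. indicator A (X k \<omega>))"
    using assms by (subst sum_ennreal[symmetric]) (auto simp: ennreal_indicator)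
  then show ?thesis
    using assms unfolding emeasure_empirical_measure[OF assms]
    by (simp only: ennreal_mult[symmetric] sum_nonneg indicator_pos_le divide_nonneg_nonneg
        of_nat_0_le_iff zero_le_one) simp
qed

lemma measurable_emeasure_empirical:
  assumes [measurable]: "A \<in> sets borel"
  shows "(\<lambda>\<omega>. emeasure (\<mu>\<^sub>N \<omega>) A) \<in> borel_measurable M"
proof -
  have [measurable]: "k \<in> {1..N} \<Longrightarrow> X k \<in> borel_measurable M" for k
    by (rule random_variable_X) auto
  show ?thesis by (subst emeasure_empirical_real) measurable
qed

text \<open>
  The first bound is the triangle inequality, the second one the comparison of the mean of \<open>|D|\<close> with the
  variance of \<open>D = \<mu>\<^sub>N(A) - \<mu>(A)\<close>, which is \<open>(m - m\<^sup>2) / N\<close> with \<open>m = \<mu>(A)\<close> because the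
  centred indicators are pairwise uncorrelated.
\<close>

lemma expected_cell_deviation_le:
  assumes A [measurable]: "A \<in> sets borel"
  shows "(\<integral>\<^sup>+ \<omega>. (emeasure (\<mu>\<^sub>N \<omega>) A - emeasure \<mu> A) + (emeasure \<mu> A - emeasure (\<mu>\<^sub>N \<omega>) A) \<partial>M)
    \<le> ennreal (min (2 * \<mu>.prob A) (sqrt (\<mu>.prob A / real N)))"
proof -
  define m where "m = \<mu>.prob A"
  define Z where "Z k \<omega> = indicator A (X k \<omega>) - m" for k \<omega>
  have X [measurable]: "X k \<in> borel_measurable M" if "k \<in> {1..N}" for k
    using that by (intro random_variable_X) auto
  have Z [measurable]: "Z k \<in> borel_measurable M" if "k \<in> {1..N}" for k
    using X[OF that] unfolding Z_def by measurable
  have m01: "0 \<le> m" "m \<le> 1" by (auto simp: m_def)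
  have Z_le: "\<bar>Z k \<omega>\<bar> \<le> 1" for k \<omega>
    using m01 by (auto simp: Z_def indicator_def)
  have Eind: "expectation (\<lambda>\<omega>. indicator A (X k \<omega>) :: real) = m" if "k \<in> {1..N}" for k
  proof -
    have "expectation (\<lambda>\<omega>. indicator A (X k \<omega>) :: real) = integral\<^sup>L (distr M borel (X k)) (indicator A)"
      using X[OF that] by (subst integral_distr) auto
    also have "\<dots> = m" using that distr_X[of k] by (simp add: m_def)
    finally show ?thesis .
  qed
  have int_ind [simp]: "integrable M (\<lambda>\<omega>. indicator A (X k \<omega>) :: real)" if "k \<in> {1..N}" for k
    using X[OF that] by (intro integrable_const_bound[of _ 1]) auto
  have int_Z [simp]: "integrable M (Z k)" if "k \<in> {1..N}" for k
    using Z[OF that] Z_le by (intro integrable_const_bound[of _ 1]) auto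
  have int_ZZ [simp]: "integrable M (\<lambda>\<omega>. Z j \<omega> * Z k \<omega>)" if "j \<in> {1..N}" "k \<in> {1..N}" for j k
    using that Z_le by (intro integrable_const_bound[of _ 1]) (auto simp: abs_mult intro!: mult_le_one)
  have EZ: "expectation (Z k) = 0" if "k \<in> {1..N}" for k
    using that Eind[OF that] by (simp add: Z_def[abs_def] prob_space)
  have EZZ: "expectation (\<lambda>\<omega>. Z j \<omega> * Z k \<omega>) = 0" if "j \<in> {1..N}" "k \<in> {1..N}" "j \<noteq> k" for j k
  proof -
    have "indep_vars (\<lambda>_. borel) X {j, k}"
      using indep_X that by (rule_tac indep_vars_subset) auto
    then have "indep_vars (\<lambda>_. borel) (\<lambda>k \<omega>. indicator A (X k \<omega>) - m) {j, k}"
      by (rule indep_vars_compose2) measurable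
    then have "indep_vars (\<lambda>_. borel) Z {j, k}" by (simp add: Z_def[abs_def])
    then have "expectation (\<lambda>\<omega>. \<Prod>i\<in>{j, k}. Z i \<omega>) = (\<Prod>i\<in>{j, k}. expectation (Z i))"
      using that by (intro indep_vars_lebesgue_integral) auto
    then show ?thesis using that EZ by simp
  qed
  have EZ2: "expectation (\<lambda>\<omega>. Z k \<omega> * Z k \<omega>) \<le> m" if "k \<in> {1..N}" for k
  proof -
    have "expectation (\<lambda>\<omega>. Z k \<omega> * Z k \<omega>)
      = expectation (\<lambda>\<omega>. (1 - 2 * m) * indicator A (X k \<omega>) + m * m)"
      by (intro Bochner_Integration.integral_cong refl) (auto simp: Z_def indicator_def algebra_simps)
    also have "\<dots> = m - m * m"
      using that by (simp add: Eind prob_space algebra_simps)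
    finally show ?thesis by simp
  qed
  define D where "D \<omega> = (\<Sum>k=1..N. Z k \<omega>) / real N" for \<omega>
  have [measurable]: "D \<in> borel_measurable M" unfolding D_def by measurable
  have D_eq: "D \<omega> = (\<Sum>k=1..N. indicator A (X k \<omega>)) / real N - m" for \<omega>
    using N by (simp add: D_def Z_def sum_subtractf diff_divide_distrib)
  have D_le: "\<bar>D \<omega>\<bar> \<le> 1" for \<omega>
  proof -
    have "\<bar>\<Sum>k=1..N. Z k \<omega>\<bar> \<le> (\<Sum>k=1..N. 1)"
      by (rule order_trans[OF sum_abs]) (intro sum_mono Z_le)
    then show ?thesis using N by (simp add: D_def)
  qed
  have int_D [simp]: "integrable M (\<lambda>\<omega>. \<bar>D \<omega>\<bar>)" "integrable M (\<lambda>\<omega>. (\<bar>D \<omega>\<bar>)\<^sup>2)"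
    using D_le by (auto intro!: integrable_const_bound[of _ 1] simp: abs_square_le_1)
  have int_S: "integrable M (\<lambda>\<omega>. \<Sum>k=1..N. indicator A (X k \<omega>) :: real)"
    by (intro Bochner_Integration.integrable_sum int_ind)
  have "expectation (\<lambda>\<omega>. \<Sum>k=1..N. indicator A (X k \<omega>) :: real) = real N * m"
    using int_ind by (subst Bochner_Integration.integral_sum) (auto simp: Eind)
  then have ES: "expectation (\<lambda>\<omega>. (\<Sum>k=1..N. indicator A (X k \<omega>)) / real N + m) = 2 * m"
    using int_S N by (subst Bochner_Integration.integral_add) (simp_all add: prob_space)
  have "integrable M (\<lambda>\<omega>. (\<Sum>k=1..N. indicator A (X k \<omega>)) / real N + m)"
    using int_S by simp
  moreover have "\<bar>D \<omega>\<bar> \<le> (\<Sum>k=1..N. indicator A (X k \<omega>)) / real N + m" for \<omega>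
  proof -
    have "0 \<le> (\<Sum>k=1..N. indicator A (X k \<omega>) :: real) / real N"
      by (intro divide_nonneg_nonneg sum_nonneg) auto
    then show ?thesis using m01 unfolding D_eq by linarith
  qed
  ultimately have "expectation (\<lambda>\<omega>. \<bar>D \<omega>\<bar>) \<le> expectation (\<lambda>\<omega>. (\<Sum>k=1..N. indicator A (X k \<omega>)) / real N + m)"
    by (intro integral_mono int_D)
  also note ES
  finally have bound1: "expectation (\<lambda>\<omega>. \<bar>D \<omega>\<bar>) \<le> 2 * m" .
  have "expectation (\<lambda>\<omega>. (\<bar>D \<omega>\<bar>)\<^sup>2)
    = expectation (\<lambda>\<omega>. (\<Sum>j=1..N. \<Sum>k=1..N. Z j \<omega> * Z k \<omega>) / (real N)\<^sup>2)"
    by (simp add: D_def power_divide power2_eq_square sum_product)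
  also have "\<dots> = expectation (\<lambda>\<omega>. \<Sum>j=1..N. \<Sum>k=1..N. Z j \<omega> * Z k \<omega>) / (real N)\<^sup>2"
    by simp
  also have "expectation (\<lambda>\<omega>. \<Sum>j=1..N. \<Sum>k=1..N. Z j \<omega> * Z k \<omega>)
      = (\<Sum>j=1..N. expectation (\<lambda>\<omega>. \<Sum>k=1..N. Z j \<omega> * Z k \<omega>))"
    by (intro Bochner_Integration.integral_sum Bochner_Integration.integrable_sum int_ZZ)
  also have "\<dots> = (\<Sum>j=1..N. \<Sum>k=1..N. expectation (\<lambda>\<omega>. Z j \<omega> * Z k \<omega>))"
    by (intro sum.cong refl Bochner_Integration.integral_sum int_ZZ)
  also have "(\<Sum>j=1..N. \<Sum>k=1..N. expectation (\<lambda>\<omega>. Z j \<omega> * Z k \<omega>))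
    = (\<Sum>j=1..N. \<Sum>k=1..N. if k = j then expectation (\<lambda>\<omega>. Z j \<omega> * Z j \<omega>) else 0)"
    using EZZ by (intro sum.cong refl) auto
  also have "\<dots> = (\<Sum>j=1..N. expectation (\<lambda>\<omega>. Z j \<omega> * Z j \<omega>))"
    by (intro sum.cong refl) simp
  also have "\<dots> \<le> (\<Sum>j=1..N. m)" by (intro sum_mono EZ2)
  also have "(\<Sum>j=1..N. m) / (real N)\<^sup>2 = m / real N"
    by (simp add: power2_eq_square)
  finally have "expectation (\<lambda>\<omega>. (\<bar>D \<omega>\<bar>)\<^sup>2) \<le> m / real N"
    by (simp add: divide_right_mono)
  moreover have "(expectation (\<lambda>\<omega>. \<bar>D \<omega>\<bar>))\<^sup>2 \<le> expectation (\<lambda>\<omega>. (\<bar>D \<omega>\<bar>)\<^sup>2)"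
    using variance_positive[of "\<lambda>\<omega>. \<bar>D \<omega>\<bar>"] by (subst (asm) variance_eq[OF int_D]) simp
  ultimately have bound2: "expectation (\<lambda>\<omega>. \<bar>D \<omega>\<bar>) \<le> sqrt (m / real N)"
    by (intro real_le_rsqrt) linarith
  have "(\<integral>\<^sup>+ \<omega>. (emeasure (\<mu>\<^sub>N \<omega>) A - emeasure \<mu> A) + (emeasure \<mu> A - emeasure (\<mu>\<^sub>N \<omega>) A) \<partial>M)
    = (\<integral>\<^sup>+ \<omega>. ennreal \<bar>D \<omega>\<bar> \<partial>M)"
    by (intro nn_integral_cong)
       (simp add: emeasure_empirical_real A \<mu>.emeasure_eq_measure ennreal_abs_diff sum_nonneg D_eq m_def)
  also have "\<dots> = ennreal (expectation (\<lambda>\<omega>. \<bar>D \<omega>\<bar>))"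
    by (rule nn_integral_eq_integral) auto
  finally show ?thesis
    using bound1 bound2 by (simp add: m_def ennreal_leI)
qed

lemma measurable_cell_discrepancy:
  fixes c :: "real ^ 'n \<Rightarrow> 'i :: countable"
  assumes c: "c \<in> measurable borel (count_space UNIV)"
  shows "(\<lambda>\<omega>. cell_discrepancy \<phi> c (\<mu>\<^sub>N \<omega>) \<mu>) \<in> borel_measurable M"
proof -
  interpret I: sigma_finite_measure "count_space (UNIV :: 'i set)"
    by (rule sigma_finite_measure_count_space_countable) (rule countableI_type)
  have [measurable]: "(\<lambda>\<omega>. emeasure (\<mu>\<^sub>N \<omega>) {x. c x = i}) \<in> borel_measurable M" for i
    using measurable_sets[OF c, of "{i}"]
    by (intro measurable_emeasure_empirical) (simp add: vimage_def)
  define h where "h \<omega> i = \<phi> i * ((emeasure (\<mu>\<^sub>N \<omega>) {x. c x = i} - emeasure \<mu> {x. c x = i})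
      + (emeasure \<mu> {x. c x = i} - emeasure (\<mu>\<^sub>N \<omega>) {x. c x = i}))" for \<omega> i
  have [measurable]: "(\<lambda>\<omega>. h \<omega> i) \<in> borel_measurable M" for i
    unfolding h_def by measurable
  have "(\<lambda>z. h (fst z) (snd z)) \<in> borel_measurable (M \<Otimes>\<^sub>M count_space UNIV)"
    by (rule measurable_compose_countable[where f = "\<lambda>i z. h (fst z) i"]) measurable
  then have "(\<lambda>\<omega>. \<integral>\<^sup>+ i. h \<omega> i \<partial>count_space UNIV) \<in> borel_measurable M"
    by (intro I.borel_measurable_nn_integral) (simp add: case_prod_beta')
  then show ?thesis
    by (simp add: cell_discrepancy_def h_def)
qed

text \<open>
  Within one annulus there are at most \<open>2\<^sup>d\<^sup>l\<close> nonempty cells, so the Cauchy-Schwarz inequality bounds the sum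
  of the square roots \<open>sqrt (\<mu>(F) / N)\<close> by the square root of the sum times \<open>2\<^sup>d\<^sup>l\<close>. The origin, whose
  weight is zero, drops out of the sum.
\<close>

lemma expected_cell_discrepancy_le:
  assumes "1 < a"
  shows "(\<integral>\<^sup>+ \<omega>. cell_discrepancy (\<lambda>i. ennreal (outer_radius a (fst i) powr p)) (cell a l) (\<mu>\<^sub>N \<omega>) \<mu> \<partial>M)
    \<le> (\<integral>\<^sup>+ n. ennreal (a powr (p * (real_of_int n + 1)))
         * ennreal (min (2 * \<mu>.prob {x. annulus a x = Some n})
             (sqrt (2 ^ (CARD('n) * l) / real N) * sqrt (\<mu>.prob {x. annulus a x = Some n}))) \<partial>count_space UNIV)"
proof -
  define F where "F = (\<lambda>n k. {x :: real ^ 'n. cell a l x = (n, k)})"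
  define B where "B n = {x :: real ^ 'n. annulus a x = n}" for n
  define K where "K = (PiE UNIV (\<lambda>_. {0..<2 ^ l}) :: ('n \<Rightarrow> int) set)"
  have K: "finite K" "card K = 2 ^ (CARD('n) * l)"
    by (simp_all add: K_def finite_PiE card_PiE nat_power_eq power_mult mult.commute)
  have F [measurable]: "F n k \<in> sets borel" for n k
    using measurable_sets[OF measurable_cell, of "{(n, k)}"] by (simp add: F_def vimage_def)
  have F_empty: "F n k = {}" if "k \<notin> K" for n k
  proof (rule ccontr)
    assume "F n k \<noteq> {}"
    then obtain x where "cell a l x = (n, k)" by (auto simp: F_def)
    then show False using that cell_coordinate_bounds[OF assms, of l x] by (auto simp: K_def)
  qed
  have sum_F: "(\<Sum>k\<in>K. \<mu>.prob (F n k)) = \<mu>.prob (B n)" for n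
  proof -
    have "(\<Sum>k\<in>K. \<mu>.prob (F n k)) = \<mu>.prob (\<Union>k\<in>K. F n k)"
      using K by (intro \<mu>.finite_measure_finite_Union[symmetric]) (auto simp: disjoint_family_on_def F_def[abs_def] sets_\<mu> intro: F[unfolded F_def])
    also have "(\<Union>k\<in>K. F n k) = B n"
    proof -
      have "x \<in> (\<Union>k\<in>K. F n k)" if "x \<in> B n" for x
      proof -
        have "x \<in> F n (snd (cell a l x))" using that by (simp add: F_def B_def cell_def)
        then show ?thesis using F_empty by blast
      qed
      then show ?thesis by (auto simp: F_def B_def cell_def)
    qed
    finally show ?thesis .
  qed
  define dev where "dev A \<omega> = (emeasure (\<mu>\<^sub>N \<omega>) A - emeasure \<mu> A) + (emeasure \<mu> A - emeasure (\<mu>\<^sub>N \<omega>) A)"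
    for A \<omega>
  have [measurable]: "dev A \<in> borel_measurable M" if "A \<in> sets borel" for A
  proof -
    note [measurable] = measurable_emeasure_empirical[OF that]
    show ?thesis unfolding dev_def by measurable
  qed
  have dev_le: "(\<Sum>k\<in>K. \<integral>\<^sup>+ \<omega>. dev (F n k) \<omega> \<partial>M)
     \<le> ennreal (min (2 * \<mu>.prob (B n)) (sqrt (2 ^ (CARD('n) * l) / real N) * sqrt (\<mu>.prob (B n))))" for n
  proof -
    have "(\<Sum>k\<in>K. \<integral>\<^sup>+ \<omega>. dev (F n k) \<omega> \<partial>M)
      \<le> (\<Sum>k\<in>K. ennreal (min (2 * \<mu>.prob (F n k)) (sqrt (\<mu>.prob (F n k) / real N))))"
      unfolding dev_def by (intro sum_mono expected_cell_deviation_le F)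
    also have "\<dots> = ennreal (\<Sum>k\<in>K. min (2 * \<mu>.prob (F n k)) (sqrt (\<mu>.prob (F n k) / real N)))"
      by (rule sum_ennreal) auto
    also have "\<dots> \<le> ennreal (min (2 * \<mu>.prob (B n)) (sqrt (2 ^ (CARD('n) * l) / real N) * sqrt (\<mu>.prob (B n))))"
    proof (intro ennreal_leI min.boundedI)
      have "(\<Sum>k\<in>K. min (2 * \<mu>.prob (F n k)) (sqrt (\<mu>.prob (F n k) / real N))) \<le> (\<Sum>k\<in>K. 2 * \<mu>.prob (F n k))"
        by (intro sum_mono) simp
      then show "(\<Sum>k\<in>K. min (2 * \<mu>.prob (F n k)) (sqrt (\<mu>.prob (F n k) / real N))) \<le> 2 * \<mu>.prob (B n)"
        by (simp add: sum_F flip: sum_distrib_left)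
      have "(\<Sum>k\<in>K. sqrt (\<mu>.prob (F n k) / real N))\<^sup>2
          \<le> (\<Sum>k\<in>K. (sqrt (\<mu>.prob (F n k) / real N))\<^sup>2) * card K"
        by (rule sum_squared_le_sum_of_squares)
      also have "\<dots> = \<mu>.prob (B n) / real N * 2 ^ (CARD('n) * l)"
        by (simp add: K(2) sum_F flip: sum_divide_distrib)
      finally have "(\<Sum>k\<in>K. sqrt (\<mu>.prob (F n k) / real N)) \<le> sqrt (\<mu>.prob (B n) / real N * 2 ^ (CARD('n) * l))"
        by (rule real_le_rsqrt)
      moreover have "(\<Sum>k\<in>K. min (2 * \<mu>.prob (F n k)) (sqrt (\<mu>.prob (F n k) / real N)))
          \<le> (\<Sum>k\<in>K. sqrt (\<mu>.prob (F n k) / real N))"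
        by (intro sum_mono) simp
      ultimately show "(\<Sum>k\<in>K. min (2 * \<mu>.prob (F n k)) (sqrt (\<mu>.prob (F n k) / real N)))
          \<le> sqrt (2 ^ (CARD('n) * l) / real N) * sqrt (\<mu>.prob (B n))"
        by (simp add: real_sqrt_mult[symmetric] mult.commute)
    qed
    finally show ?thesis .
  qed
  let ?\<phi> = "\<lambda>n. ennreal (outer_radius a n powr p)"
  let ?G = "\<lambda>n. ?\<phi> n * ennreal (min (2 * \<mu>.prob (B n)) (sqrt (2 ^ (CARD('n) * l) / real N) * sqrt (\<mu>.prob (B n))))"
  have "(\<integral>\<^sup>+ \<omega>. cell_discrepancy (\<lambda>i. ?\<phi> (fst i)) (cell a l) (\<mu>\<^sub>N \<omega>) \<mu> \<partial>M)
    = (\<integral>\<^sup>+ \<omega>. \<integral>\<^sup>+ i. ?\<phi> (fst i) * dev (F (fst i) (snd i)) \<omega> \<partial>count_space UNIV \<partial>M)"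
    by (simp add: cell_discrepancy_def dev_def F_def)
  also have "\<dots> = (\<integral>\<^sup>+ i. \<integral>\<^sup>+ \<omega>. ?\<phi> (fst i) * dev (F (fst i) (snd i)) \<omega> \<partial>M \<partial>count_space UNIV)"
    by (rule nn_integral_count_space_nn_integral) (auto intro: countableI_type)
  also have "\<dots> = (\<integral>\<^sup>+ i. ?\<phi> (fst i) * (\<integral>\<^sup>+ \<omega>. dev (F (fst i) (snd i)) \<omega> \<partial>M) \<partial>count_space UNIV)"
    by (intro nn_integral_cong nn_integral_cmult) measurable
  also have "\<dots> = (\<integral>\<^sup>+ n. \<integral>\<^sup>+ k. ?\<phi> n * (\<integral>\<^sup>+ \<omega>. dev (F n k) \<omega> \<partial>M) \<partial>count_space UNIV \<partial>count_space UNIV)"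
    by (subst nn_integral_fst_count_space[symmetric]) simp
  also have "\<dots> = (\<integral>\<^sup>+ n. (\<Sum>k\<in>K. ?\<phi> n * (\<integral>\<^sup>+ \<omega>. dev (F n k) \<omega> \<partial>M)) \<partial>count_space UNIV)"
    using K by (intro nn_integral_cong nn_integral_count_space') (auto simp: F_empty dev_def)
  also have "\<dots> \<le> (\<integral>\<^sup>+ n. ?G n \<partial>count_space UNIV)"
    by (intro nn_integral_mono) (simp add: mult_left_mono dev_le flip: sum_distrib_left)
  also have "\<dots> = (\<integral>\<^sup>+ n. ?G n \<partial>count_space (range Some))"
    by (rule nn_integral_count_space_eq) (auto simp: outer_radius_def notin_range_Some)
  also have "\<dots> = (\<integral>\<^sup>+ n. ?G (Some n) \<partial>count_space UNIV)"
    by (rule nn_integral_bij_count_space[symmetric]) (simp add: inj_on_imp_bij_betw)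
  finally show ?thesis
    by (simp add: outer_radius_def B_def powr_powr mult.commute)
qed

end

section \<open>Summation over the annuli\<close>

lemma powr_le_linear_interpolation:
  fixes s t :: real
  assumes "0 < s" "0 \<le> t" "t \<le> 1"
  shows "s powr t \<le> 1 + t * (s - 1)"
proof -
  have "exp ((1 - t) *\<^sub>R 0 + t *\<^sub>R ln s) \<le> (1 - t) * exp 0 + t * exp (ln s)"
    using assms by (intro convex_onD[OF exp_convex]) auto
  then show ?thesis using assms by (simp add: powr_def algebra_simps)
qed

lemma nn_integral_count_space_int_split:
  fixes f :: "int \<Rightarrow> ennreal"
  shows "(\<integral>\<^sup>+ n. f n \<partial>count_space UNIV) = (\<Sum>k. f (n0 + int k)) + (\<Sum>k. f (n0 - 1 - int k))"
proof -
  have "bij_betw (\<lambda>k. n0 + int k) UNIV {n0..}"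
    by (rule bij_betwI[where g = "\<lambda>n. nat (n - n0)"]) auto
  then have 1: "(\<integral>\<^sup>+ n. f n \<partial>count_space {n0..}) = (\<Sum>k. f (n0 + int k))"
    by (simp add: nn_integral_bij_count_space[symmetric] nn_integral_count_space_nat)
  have "bij_betw (\<lambda>k. n0 - 1 - int k) UNIV {..<n0}"
    by (rule bij_betwI[where g = "\<lambda>n. nat (n0 - 1 - n)"]) auto
  then have 2: "(\<integral>\<^sup>+ n. f n \<partial>count_space {..<n0}) = (\<Sum>k. f (n0 - 1 - int k))"
    by (simp add: nn_integral_bij_count_space[symmetric] nn_integral_count_space_nat)
  have "(\<integral>\<^sup>+ n. f n \<partial>count_space UNIV)
    = (\<integral>\<^sup>+ n. f n * indicator {n0..} n + f n * indicator {..<n0} n \<partial>count_space UNIV)"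
    by (intro nn_integral_cong) (auto split: split_indicator)
  also have "\<dots> = (\<integral>\<^sup>+ n. f n \<partial>count_space {n0..}) + (\<integral>\<^sup>+ n. f n \<partial>count_space {..<n0})"
    by (subst nn_integral_add) (auto simp: nn_integral_count_space_indicator)
  finally show ?thesis by (simp add: 1 2)
qed

text \<open>
  Let \<open>R\<close> be the radius where the two bounds agree, put \<open>s = a\<^sup>p\<^sup>-\<^sup>q < 1\<close>, \<open>r = a\<^sup>p\<^sup>-\<^sup>q\<^sup>/\<^sup>2 > 1\<close>, and let \<open>a\<^sup>n\<^sup>0 = R a\<^sup>t\<close> be the
  first power of \<open>a\<close> that is at least \<open>R\<close>. Using the bound \<open>2 m n\<close> from \<open>n0\<close> on and the other
  one below, both geometric series together are a fixed multiple of
  \<open>s\<^sup>t / (1 - s) + r\<^sup>t / (r - 1)\<close> with \<open>t \<in> [0, 1]\<close>. Both summands are convex in \<open>t\<close>; as their chords have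
  the slopes \<open>-1\<close> and \<open>1\<close>, the sum is at most its value at \<open>t = 0\<close>, whatever the position
  of \<open>R\<close> between the powers of \<open>a\<close>.
\<close>

lemma two_sided_geometric_sum_le:
  fixes a p q c M :: real and m :: "int \<Rightarrow> real"
  assumes "1 < a" "0 < p" "p < q" "q < 2 * p" "0 < c" "0 \<le> M"
    and m: "\<And>n. 0 \<le> m n" "\<And>n. m n \<le> M * a powr (- q * real_of_int n)"
  shows "(\<integral>\<^sup>+ n. ennreal (a powr (p * (real_of_int n + 1))) * ennreal (min (2 * m n) (c * sqrt (m n))) \<partial>count_space UNIV)
     \<le> ennreal (2 * M powr (p / q) * (c / 2) powr (2 * (q - p) / q) * zeta_fun p q a)"
proof (cases "M = 0")
  case True
  then have "m n = 0" for n using m[of n] by simp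
  then show ?thesis by simp
next
  case False
  then have M: "0 < M" using assms by simp
  define s r where "s = a powr (p - q)" and "r = a powr (p - q / 2)"
  have s: "0 < s" "s < 1" and r: "1 < r"
    using assms by (auto simp: s_def r_def powr_less_one intro: gr_one_powr)
  define R where "R = (M / (c / 2)\<^sup>2) powr (1 / q)"
  have R: "0 < R" using M assms by (simp add: R_def)
  define n0 where "n0 = \<lceil>log a R\<rceil>"
  define t where "t = real_of_int n0 - log a R"
  have t: "0 \<le> t" "t \<le> 1" unfolding t_def n0_def by linarith+
  have n0: "a powr (e * real_of_int n0) = R powr e * (a powr e) powr t" for e
  proof -
    have "R powr e * (a powr e) powr t = a powr (log a R * e) * a powr (e * t)"
      using R assms by (simp add: powr_powr[symmetric])
    also have "\<dots> = a powr (e * real_of_int n0)"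
      by (simp add: powr_add[symmetric] t_def algebra_simps)
    finally show ?thesis ..
  qed
  \<comment> \<open>Both bounds agree at radius \<open>R\<close>, so the two geometric series have the same leading coefficient.\<close>
  have balance: "c * sqrt M * R powr (p - q / 2) = 2 * M * R powr (p - q)"
  proof -
    have "R powr (q / 2) = sqrt (M / (c / 2)\<^sup>2)"
      using assms M by (simp add: R_def powr_powr powr_half_sqrt)
    also have "\<dots> = sqrt M / (c / 2)"
      using assms by (simp add: real_sqrt_divide)
    finally have half: "R powr (q / 2) = sqrt M / (c / 2)" .
    have "c * sqrt M * R powr (q / 2) = 2 * (sqrt M * sqrt M)"
      unfolding half using \<open>0 < c\<close> by (simp del: real_sqrt_mult_self)
    moreover have "R powr (p - q / 2) = R powr (p - q) * R powr (q / 2)"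
      by (simp add: powr_add[symmetric])
    ultimately show ?thesis using M by (simp add: mult_ac)
  qed
  have moment_scale: "M * R powr (p - q) = M powr (p / q) * (c / 2) powr (2 * (q - p) / q)"
  proof -
    have "R powr (p - q) = (M / (c / 2)\<^sup>2) powr ((p - q) / q)"
      by (simp add: R_def powr_powr)
    also have "\<dots> = M powr ((p - q) / q) / ((c / 2) powr 2) powr ((p - q) / q)"
      using M assms by (subst powr_divide) auto
    also have "\<dots> = M powr ((p - q) / q) * (c / 2) powr (- (2 * ((p - q) / q)))"
      by (simp only: powr_powr powr_minus divide_inverse)
    also have "- (2 * ((p - q) / q)) = 2 * (q - p) / q" using assms by (simp add: field_simps)
    finally have "M * R powr (p - q) = M powr 1 * M powr ((p - q) / q) * (c / 2) powr (2 * (q - p) / q)"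
      using M by simp
    also have "M powr 1 * M powr ((p - q) / q) = M powr (p / q)"
      unfolding powr_add[symmetric] using assms by (simp add: field_simps)
    finally show ?thesis .
  qed
  define g where "g n = a powr (p * (real_of_int n + 1)) * min (2 * m n) (c * sqrt (m n))" for n
  have g_high: "g n \<le> 2 * M * a powr p * a powr ((p - q) * real_of_int n)" for n
  proof -
    have "g n \<le> a powr (p * (real_of_int n + 1)) * (2 * (M * a powr (- q * real_of_int n)))"
      unfolding g_def using m(2)[of n] by (intro mult_left_mono) auto
    also have "\<dots> = 2 * M * (a powr (p * (real_of_int n + 1)) * a powr (- q * real_of_int n))" by simp
    also have "a powr (p * (real_of_int n + 1)) * a powr (- q * real_of_int n)
        = a powr p * a powr ((p - q) * real_of_int n)"
      by (simp only: powr_add[symmetric]) (simp add: algebra_simps)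
    finally show ?thesis by simp
  qed
  have g_low: "g n \<le> c * sqrt M * a powr p * a powr ((p - q / 2) * real_of_int n)" for n
  proof -
    have "sqrt (m n) \<le> sqrt (M * a powr (- q * real_of_int n))" using m(2) by simp
    also have "\<dots> = sqrt M * a powr (- q / 2 * real_of_int n)"
      using assms by (simp add: real_sqrt_mult powr_half_sqrt[symmetric] powr_powr)
    finally have "g n \<le> a powr (p * (real_of_int n + 1)) * (c * (sqrt M * a powr (- q / 2 * real_of_int n)))"
      unfolding g_def using assms by (intro mult_left_mono min.coboundedI2) auto
    also have "\<dots> = c * sqrt M * (a powr (p * (real_of_int n + 1)) * a powr (- q / 2 * real_of_int n))" by simp
    also have "a powr (p * (real_of_int n + 1)) * a powr (- q / 2 * real_of_int n)
        = a powr p * a powr ((p - q / 2) * real_of_int n)"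
      by (simp only: powr_add[symmetric]) (simp add: algebra_simps)
    finally show ?thesis by simp
  qed
  have high: "(\<Sum>k. ennreal (g (n0 + int k))) \<le> ennreal (2 * M * R powr (p - q) * a powr p * (s powr t / (1 - s)))"
  proof -
    have "(\<Sum>k. ennreal (g (n0 + int k))) \<le> (\<Sum>k. ennreal (2 * M * R powr (p - q) * a powr p * s powr t * s ^ k))"
    proof (intro suminf_le ennreal_leI summableI)
      fix k
      have "a powr ((p - q) * real_of_int (n0 + int k)) = a powr ((p - q) * real_of_int n0) * a powr ((p - q) * real k)"
        by (simp add: powr_add[symmetric] algebra_simps)
      also have "a powr ((p - q) * real k) = s ^ k"
        using s by (simp add: s_def powr_powr[symmetric] powr_realpow)
      finally show "g (n0 + int k) \<le> 2 * M * R powr (p - q) * a powr p * s powr t * s ^ k"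
        using g_high[of "n0 + int k"] n0[of "p - q"] by (simp add: s_def mult_ac)
    qed
    also have "\<dots> = ennreal (2 * M * R powr (p - q) * a powr p * s powr t * (1 / (1 - s)))"
      using s M by (intro suminf_ennreal_eq sums_mult geometric_sums) auto
    finally show ?thesis by simp
  qed
  have low: "(\<Sum>k. ennreal (g (n0 - 1 - int k))) \<le> ennreal (2 * M * R powr (p - q) * a powr p * (r powr t / (r - 1)))"
  proof -
    have "(\<Sum>k. ennreal (g (n0 - 1 - int k)))
        \<le> (\<Sum>k. ennreal (c * sqrt M * R powr (p - q / 2) * a powr p * r powr t * (1 / r) * (1 / r) ^ k))"
    proof (intro suminf_le ennreal_leI summableI)
      fix k
      have "a powr ((p - q / 2) * real_of_int (n0 - 1 - int k))
          = a powr ((p - q / 2) * real_of_int n0) * a powr (- ((p - q / 2) * real (Suc k)))"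
        by (simp add: powr_add[symmetric] algebra_simps)
      also have "a powr (- ((p - q / 2) * real (Suc k))) = (1 / r) ^ Suc k"
      proof -
        have "a powr ((p - q / 2) * real (Suc k)) = r ^ Suc k"
          using powr_realpow[of r "Suc k"] r by (simp only: r_def powr_powr)
        then show ?thesis by (simp only: powr_minus power_one_over inverse_eq_divide)
      qed
      finally show "g (n0 - 1 - int k) \<le> c * sqrt M * R powr (p - q / 2) * a powr p * r powr t * (1 / r) * (1 / r) ^ k"
        using g_low[of "n0 - 1 - int k"] n0[of "p - q / 2"] by (simp add: r_def mult_ac)
    qed
    also have "\<dots> = ennreal (c * sqrt M * R powr (p - q / 2) * a powr p * r powr t * (1 / r) * (1 / (1 - 1 / r)))"
      using r M assms by (intro suminf_ennreal_eq sums_mult geometric_sums) auto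
    also have "c * sqrt M * R powr (p - q / 2) * a powr p * r powr t * (1 / r) * (1 / (1 - 1 / r))
        = 2 * M * R powr (p - q) * a powr p * (r powr t * ((1 / r) * (1 / (1 - 1 / r))))"
      unfolding balance by simp
    also have "(1 / r) * (1 / (1 - 1 / r)) = 1 / (r - 1)"
      using r by (simp add: field_simps)
    finally show ?thesis by simp
  qed
  have "(\<integral>\<^sup>+ n. ennreal (a powr (p * (real_of_int n + 1))) * ennreal (min (2 * m n) (c * sqrt (m n))) \<partial>count_space UNIV)
    = (\<integral>\<^sup>+ n. ennreal (g n) \<partial>count_space UNIV)"
    using m assms by (intro nn_integral_cong) (simp add: g_def ennreal_mult)
  also have "\<dots> \<le> ennreal (2 * M * R powr (p - q) * a powr p * (s powr t / (1 - s)))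
      + ennreal (2 * M * R powr (p - q) * a powr p * (r powr t / (r - 1)))"
    unfolding nn_integral_count_space_int_split[of _ n0] by (intro add_mono high low)
  also have "\<dots> = ennreal (2 * M * R powr (p - q) * a powr p * (s powr t / (1 - s) + r powr t / (r - 1)))"
    using s r M by (simp add: ennreal_plus[symmetric] distrib_left del: ennreal_plus)
  also have "\<dots> \<le> ennreal (2 * M * R powr (p - q) * a powr p * (1 / (1 - s) + 1 / (r - 1)))"
  proof (intro ennreal_leI mult_left_mono)
    have "s powr t / (1 - s) \<le> (1 + t * (s - 1)) / (1 - s)"
      using s t by (intro divide_right_mono powr_le_linear_interpolation) auto
    also have "\<dots> = 1 / (1 - s) - t" using s by (simp add: field_simps)
    finally have "s powr t / (1 - s) \<le> 1 / (1 - s) - t" .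
    moreover have "r powr t / (r - 1) \<le> (1 + t * (r - 1)) / (r - 1)"
      using r t by (intro divide_right_mono powr_le_linear_interpolation) auto
    moreover have "(1 + t * (r - 1)) / (r - 1) = 1 / (r - 1) + t" using r by (simp add: field_simps)
    ultimately show "s powr t / (1 - s) + r powr t / (r - 1) \<le> 1 / (1 - s) + 1 / (r - 1)" by linarith
  qed (use M in auto)
  also have "2 * M * R powr (p - q) * a powr p * (1 / (1 - s) + 1 / (r - 1))
      = 2 * M powr (p / q) * (c / 2) powr (2 * (q - p) / q) * zeta_fun p q a"
  proof -
    have "zeta_fun p q a = a powr p * (1 / (1 - s) + 1 / (r - 1))"
      by (simp add: zeta_fun_def s_def r_def distrib_left add.commute)
    moreover have "2 * M * R powr (p - q) = 2 * M powr (p / q) * (c / 2) powr (2 * (q - p) / q)"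
      using moment_scale by simp
    ultimately show ?thesis by simp
  qed
  finally show ?thesis .
qed

section \<open>Summation over the levels\<close>

text \<open>
  The assumptions on \<open>q\<close> distinguish whether \<open>p\<close> is above or below \<open>d / 2\<close>, but both conclusions hold in both
  cases: the second one reads \<open>d (q - p) < p q\<close>, and comparing \<open>d\<close> with \<open>2 p\<close> deduces either from the other.
\<close>

lemma exponent_conditions:
  fixes d p q :: real
  assumes "0 < p" "p < q" "p \<ge> d / 2 \<Longrightarrow> q < 2 * p" "p \<le> d / 2 \<Longrightarrow> q < d * p / (d - p)"
  shows "q < 2 * p" "d - p - d * p / q < 0"
proof -
  have "q < 2 * p \<and> d * (q - p) < p * q"
  proof (cases "p \<ge> d / 2")
    case True
    then have q: "q < 2 * p" using assms by blast
    have "d * (q - p) \<le> (2 * p) * (q - p)"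
      using True assms by (intro mult_right_mono) auto
    also have "(2 * p) * (q - p) = p * q - p * (2 * p - q)" by (simp add: algebra_simps)
    also have "\<dots> < p * q" using q assms by simp
    finally show ?thesis using q by blast
  next
    case False
    then have "q * (d - p) < d * p"
      using assms by (simp add: pos_less_divide_eq)
    then have d: "d * (q - p) < p * q" by (simp add: algebra_simps)
    have "(2 * p) * (q - p) \<le> d * (q - p)"
      using False assms by (intro mult_right_mono) auto
    with d have "p * (2 * (q - p)) < p * q" by (simp only: mult_ac)
    then have "2 * (q - p) < q" using assms by (simp only: mult_less_cancel_left_pos)
    then have "q < 2 * p" by simp
    with d show ?thesis by blast
  qed
  then show "q < 2 * p" "d - p - d * p / q < 0"
    using assms by (auto simp: field_simps)
qed

context iid_sample
begin

text \<open>
  Markov's inequality, on an annulus where \<open>|x| \<ge> a\<^sup>n\<close>.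
\<close>

lemma prob_annulus_le:
  assumes "1 < a" "0 < q" "moment q \<mu> = ennreal K" "0 \<le> K"
  shows "\<mu>.prob {x. annulus a x = Some n} \<le> K * a powr (- q * real_of_int n)"
proof -
  let ?B = "{x :: real ^ 'n. annulus a x = Some n}"
  have [measurable]: "?B \<in> sets borel"
    using measurable_sets[OF measurable_annulus, of "{Some n}"] by (simp add: vimage_def)
  have inner: "a powr real_of_int n \<le> infnorm x" if "annulus a x = Some n" for x :: "real ^ 'n"
  proof -
    have x: "x \<noteq> 0" "n = \<lfloor>log a (infnorm x)\<rfloor>"
      using that by (auto simp: annulus_def split: if_splits)
    then have "real_of_int n \<le> log a (infnorm x)" by linarith
    then show ?thesis
      using x(1) assms(1) by (subst (asm) le_log_iff) (auto simp: infnorm_pos_lt)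
  qed
  have "ennreal (a powr (q * real_of_int n) * \<mu>.prob ?B) = (\<integral>\<^sup>+ x. ennreal (a powr (q * real_of_int n)) * indicator ?B x \<partial>\<mu>)"
    by (subst nn_integral_cmult_indicator) (auto simp: \<mu>.emeasure_eq_measure ennreal_mult)
  also have "\<dots> \<le> moment q \<mu>"
    unfolding moment_def
  proof (intro nn_integral_mono)
    fix x :: "real ^ 'n"
    have "a powr (q * real_of_int n) = (a powr real_of_int n) powr q"
      by (simp add: powr_powr mult.commute)
    moreover have "(a powr real_of_int n) powr q \<le> infnorm x powr q" if "annulus a x = Some n"
      using inner[OF that] assms by (intro powr_mono2) auto
    ultimately show "ennreal (a powr (q * real_of_int n)) * indicator ?B x \<le> ennreal (infnorm x powr q)"
      by (auto simp: indicator_def intro!: ennreal_leI)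
  qed
  finally have "a powr (q * real_of_int n) * \<mu>.prob ?B \<le> K"
    using assms by simp
  then show ?thesis
    using assms(1) by (simp add: powr_minus field_simps)
qed

text \<open>
  The two-sided sum for \<open>c = sqrt (2\<^sup>d\<^sup>l / N)\<close>.
\<close>

lemma expected_discrepancy_at_scale_le:
  assumes a: "1 < a" and pq: "0 < p" "p < q" "q < 2 * p"
    and K: "moment q \<mu> = ennreal K" "0 \<le> K"
  shows "(\<integral>\<^sup>+ \<omega>. cell_discrepancy (\<lambda>i. ennreal (outer_radius a (fst i) powr p)) (cell a l) (\<mu>\<^sub>N \<omega>) \<mu> \<partial>M)
    \<le> ennreal (2 * K powr (p / q) * zeta_fun p q a / real N powr ((q - p) / q)
         * 2 powr ((real CARD('n) * real l / 2 - 1) * (2 * (q - p) / q)))"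
proof -
  define c where "c = sqrt (2 ^ (CARD('n) * l) / real N)"
  have c: "0 < c" using N by (simp add: c_def)
  have "(\<integral>\<^sup>+ \<omega>. cell_discrepancy (\<lambda>i. ennreal (outer_radius a (fst i) powr p)) (cell a l) (\<mu>\<^sub>N \<omega>) \<mu> \<partial>M)
    \<le> ennreal (2 * K powr (p / q) * (c / 2) powr (2 * (q - p) / q) * zeta_fun p q a)"
    unfolding c_def
    by (rule order_trans[OF expected_cell_discrepancy_le[OF a] two_sided_geometric_sum_le])
       (use a pq K c prob_annulus_le[OF a _ K] in \<open>auto simp: c_def\<close>)
  also have "c / 2 = 2 powr (real CARD('n) * real l / 2 - 1) / real N powr (1 / 2)"
    using N by (simp add: c_def real_sqrt_divide powr_half_sqrt[symmetric] powr_diff powr_powr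
        powr_realpow[symmetric])
  also have "\<dots> powr (2 * (q - p) / q)
      = 2 powr ((real CARD('n) * real l / 2 - 1) * (2 * (q - p) / q)) / real N powr ((q - p) / q)"
  proof -
    have "1 / 2 * (2 * (q - p) / q) = (q - p) / q" using pq by (simp add: field_simps)
    then show ?thesis
      by (subst powr_divide) (simp_all only: powr_powr powr_ge_zero)
  qed
  finally show ?thesis by (simp add: mult_ac)
qed

text \<open>
  Only finiteness matters, because this integral is multiplied by a factor that tends to zero.
\<close>

lemma annulus_radius_integral_finite:
  assumes a: "1 < a" and pq: "0 < p" "p < q" and K: "moment q \<mu> = ennreal K" "0 \<le> K"
  obtains I where "0 \<le> I" "(\<integral>\<^sup>+ y. ennreal (outer_radius a (annulus a y) powr p) \<partial>\<mu>) \<le> ennreal I"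
proof -
  have [measurable]: "infnorm \<in> borel_measurable (borel :: (real ^ 'n) measure)"
    by (intro borel_measurable_continuous_onI continuous_on_infnorm continuous_on_id)
  have "outer_radius a (annulus a y) powr p \<le> a powr p * (1 + infnorm y powr q)" for y :: "real ^ 'n"
  proof -
    have "infnorm y powr p \<le> 1 + infnorm y powr q"
    proof (cases "infnorm y \<le> 1")
      case True
      then have "infnorm y powr p \<le> 1 powr p"
        using pq by (intro powr_mono2) (auto simp: infnorm_pos_le)
      moreover have "0 \<le> infnorm y powr q" by simp
      ultimately show ?thesis unfolding powr_one_eq_one by linarith
    next
      case False
      then have "infnorm y powr p \<le> infnorm y powr q" using pq by (intro powr_mono) auto
      then show ?thesis by simp
    qed
    then have growth: "a powr p * infnorm y powr p \<le> a powr p * (1 + infnorm y powr q)"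
      by (intro mult_left_mono) auto
    have "outer_radius a (annulus a y) powr p \<le> (a * infnorm y) powr p"
      using pq outer_radius_le[OF a] by (intro powr_mono2) (auto simp: outer_radius_nonneg)
    also have "\<dots> = a powr p * infnorm y powr p"
      using a by (simp add: powr_mult infnorm_pos_le)
    finally show ?thesis using growth by (rule order_trans)
  qed
  then have "(\<integral>\<^sup>+ y. ennreal (outer_radius a (annulus a y) powr p) \<partial>\<mu>)
      \<le> (\<integral>\<^sup>+ y. ennreal (a powr p) * (1 + ennreal (infnorm y powr q)) \<partial>\<mu>)"
    by (intro nn_integral_mono)
       (simp add: ennreal_mult[symmetric] ennreal_plus[symmetric] ennreal_leI
         flip: ennreal_1 del: ennreal_plus)
  also have "\<dots> = ennreal (a powr p) * (1 + moment q \<mu>)"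
    by (simp add: nn_integral_cmult nn_integral_add moment_def \<mu>.emeasure_space_1)
  also have "\<dots> = ennreal (a powr p * (1 + K))"
    using K by (simp add: ennreal_mult ennreal_plus)
  finally show ?thesis using that[of "a powr p * (1 + K)"] K by auto
qed

text \<open>
  The constant that the argument yields for a fixed ratio \<open>a\<close>.
\<close>

theorem expected_transport_cost_le:
  assumes a: "1 < a" and pq: "0 < p" "p < q" "q < 2 * p" and d: "real CARD('n) - p - real CARD('n) * p / q < 0"
    and K: "moment q \<mu> = ennreal K" "0 \<le> K"
  shows "(\<integral>\<^sup>+ \<omega>. transport_cost p (\<mu>\<^sub>N \<omega>) \<mu> \<partial>M)
    \<le> ennreal (2 powr p * K powr (p / q) * ((eps_const p * 2 powr (2 * p / q - 1)
      + 2 powr ((real CARD('n) / 2 - 1) * (2 * (q - p) / q))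
        * ((1 - 2 powr (- p)) / (1 - 2 powr (real CARD('n) - p - real CARD('n) * p / q))))
     * zeta_fun p q a) / real N powr ((q - p) / q))"
proof -
  define \<phi> where "\<phi> = (\<lambda>i :: int option \<times> ('n \<Rightarrow> int). ennreal (outer_radius a (fst i) powr p))"
  define w where "w l = 2 powr (- p * real l)" for l
  define e where "e = 2 * (q - p) / q"
  define T where "T = K powr (p / q) * zeta_fun p q a / real N powr ((q - p) / q)"
  define \<theta> where "\<theta> = 2 powr (real CARD('n) - p - real CARD('n) * p / q)"
  have \<theta>: "0 < \<theta>" "\<theta> < 1" using d by (auto simp: \<theta>_def powr_less_one)
  have T: "0 \<le> T" using zeta_fun_pos[OF pq a] by (simp add: T_def)
  have eps: "0 \<le> eps_const p" by (simp add: eps_const_def le_max_iff_disj)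
  obtain I where I: "0 \<le> I" "(\<integral>\<^sup>+ y. ennreal (outer_radius a (annulus a y) powr p) \<partial>\<mu>) \<le> ennreal I"
    using annulus_radius_integral_finite[OF a pq(1,2) K] .
  have w: "w (l - 1) - w l \<ge> 0" for l
    using pq by (simp add: w_def)
  have [measurable]: "(\<lambda>\<omega>. cell_discrepancy \<phi> (cell a l) (\<mu>\<^sub>N \<omega>) \<mu>) \<in> borel_measurable M" for l
    by (rule measurable_cell_discrepancy[OF measurable_cell])
  have disc: "(\<integral>\<^sup>+ \<omega>. cell_discrepancy \<phi> (cell a l) (\<mu>\<^sub>N \<omega>) \<mu> \<partial>M)
      \<le> ennreal (2 * T * 2 powr ((real CARD('n) * real l / 2 - 1) * e))" for l
    using expected_discrepancy_at_scale_le[OF a pq K, of l] by (simp add: \<phi>_def T_def e_def mult_ac)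
  define b0 where "b0 = 2 powr p * eps_const p * (2 * T * 2 powr (- e))"
  define S where "S = 2 powr p * T * (1 - 2 powr (- p)) * 2 powr ((real CARD('n) / 2 - 1) * e) * (1 / (1 - \<theta>))"
  \<comment> \<open>The contribution of level \<open>k + 1\<close>; \<open>\<theta>\<close> combines the decay \<open>2\<^sup>-\<^sup>p\<close> of the cost per level with the growth of the number of cells.\<close>
  have term_eq: "2 powr p * (w k - w (Suc k)) / 2 * (2 * T * 2 powr ((real CARD('n) * real (Suc k) / 2 - 1) * e))
      = 2 powr p * T * (1 - 2 powr (- p)) * 2 powr ((real CARD('n) / 2 - 1) * e) * \<theta> ^ k" for k
  proof -
    have "w k - w (Suc k) = (1 - 2 powr (- p)) * 2 powr (- p * real k)"
      by (simp add: w_def algebra_simps flip: powr_add)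
    moreover have "2 powr ((real CARD('n) * real (Suc k) / 2 - 1) * e)
        = 2 powr ((real CARD('n) / 2 - 1) * e) * 2 powr (real CARD('n) * e / 2 * real k)"
      by (simp add: algebra_simps add_divide_distrib flip: powr_add)
    moreover have "2 powr (- p * real k) * 2 powr (real CARD('n) * e / 2 * real k) = \<theta> ^ k"
    proof -
      have "real CARD('n) * e / 2 - p = real CARD('n) - p - real CARD('n) * p / q"
        using pq by (simp add: e_def field_simps)
      then have "\<theta> = 2 powr (real CARD('n) * e / 2 - p)" by (simp only: \<theta>_def)
      then have "\<theta> ^ k = 2 powr ((real CARD('n) * e / 2 - p) * real k)"
        by (simp only: powr_powr[symmetric] powr_realpow powr_gt_zero)
      then show ?thesis by (simp add: algebra_simps flip: powr_add)
    qed
    ultimately show ?thesis by (simp add: mult.assoc mult.left_commute)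
  qed
  have finite_levels: "(\<integral>\<^sup>+ \<omega>. transport_cost p (\<mu>\<^sub>N \<omega>) \<mu> \<partial>M) \<le> ennreal (b0 + 2 powr p * w L * I + S)" for L
  proof -
    have "(\<integral>\<^sup>+ \<omega>. transport_cost p (\<mu>\<^sub>N \<omega>) \<mu> \<partial>M)
      \<le> (\<integral>\<^sup>+ \<omega>. ennreal (2 powr p * eps_const p) * cell_discrepancy \<phi> (cell a 0) (\<mu>\<^sub>N \<omega>) \<mu>
         + ennreal (2 powr p * w L) * (\<integral>\<^sup>+ y. ennreal (outer_radius a (annulus a y) powr p) \<partial>\<mu>)
         + (\<Sum>l=1..L. ennreal (2 powr p * (w (l - 1) - w l) / 2) * cell_discrepancy \<phi> (cell a l) (\<mu>\<^sub>N \<omega>) \<mu>) \<partial>M)"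
      unfolding w_def \<phi>_def
      by (intro nn_integral_mono transport_cost_le_cell_discrepancies a pq prob_space_empirical_measure N
          sets_empirical_measure prob_\<mu> sets_\<mu>)
    also have "\<dots> = ennreal (2 powr p * eps_const p) * (\<integral>\<^sup>+ \<omega>. cell_discrepancy \<phi> (cell a 0) (\<mu>\<^sub>N \<omega>) \<mu> \<partial>M)
         + ennreal (2 powr p * w L) * (\<integral>\<^sup>+ y. ennreal (outer_radius a (annulus a y) powr p) \<partial>\<mu>)
         + (\<Sum>l=1..L. ennreal (2 powr p * (w (l - 1) - w l) / 2) * (\<integral>\<^sup>+ \<omega>. cell_discrepancy \<phi> (cell a l) (\<mu>\<^sub>N \<omega>) \<mu> \<partial>M))"
      by (simp add: nn_integral_add nn_integral_cmult nn_integral_sum emeasure_space_1)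
    also have "\<dots> \<le> ennreal (2 powr p * eps_const p) * ennreal (2 * T * 2 powr ((real CARD('n) * real 0 / 2 - 1) * e))
         + ennreal (2 powr p * w L) * ennreal I
         + (\<Sum>l=1..L. ennreal (2 powr p * (w (l - 1) - w l) / 2) * ennreal (2 * T * 2 powr ((real CARD('n) * real l / 2 - 1) * e)))"
      by (intro add_mono sum_mono mult_left_mono disc I(2)) auto
    also have "\<dots> = ennreal (b0 + 2 powr p * w L * I
         + (\<Sum>l=1..L. 2 powr p * (w (l - 1) - w l) / 2 * (2 * T * 2 powr ((real CARD('n) * real l / 2 - 1) * e))))"
    proof -
      have "(\<Sum>l=1..L. ennreal (2 powr p * (w (l - 1) - w l) / 2) * ennreal (2 * T * 2 powr ((real CARD('n) * real l / 2 - 1) * e)))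
        = ennreal (\<Sum>l=1..L. 2 powr p * (w (l - 1) - w l) / 2 * (2 * T * 2 powr ((real CARD('n) * real l / 2 - 1) * e)))"
      proof (subst sum_ennreal[symmetric])
        show "0 \<le> 2 powr p * (w (l - 1) - w l) / 2 * (2 * T * 2 powr ((real CARD('n) * real l / 2 - 1) * e))" for l
          by (intro mult_nonneg_nonneg divide_nonneg_pos w) (auto simp: T)
        show "(\<Sum>l=1..L. ennreal (2 powr p * (w (l - 1) - w l) / 2) * ennreal (2 * T * 2 powr ((real CARD('n) * real l / 2 - 1) * e)))
          = (\<Sum>l=1..L. ennreal (2 powr p * (w (l - 1) - w l) / 2 * (2 * T * 2 powr ((real CARD('n) * real l / 2 - 1) * e))))"
          using T w by (intro sum.cong refl ennreal_mult[symmetric]) simp_all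
      qed
      moreover have "0 \<le> (\<Sum>l=1..L. 2 powr p * (w (l - 1) - w l) / 2 * (2 * T * 2 powr ((real CARD('n) * real l / 2 - 1) * e)))"
        by (intro sum_nonneg mult_nonneg_nonneg divide_nonneg_pos w) (auto simp: T)
      moreover have "0 \<le> 2 powr p * w L" by (simp add: w_def)
      ultimately show ?thesis
        using T eps I by (simp add: b0_def ennreal_mult ennreal_plus)
    qed
    also have "(\<Sum>l=1..L. 2 powr p * (w (l - 1) - w l) / 2 * (2 * T * 2 powr ((real CARD('n) * real l / 2 - 1) * e)))
       = (\<Sum>k<L. 2 powr p * T * (1 - 2 powr (- p)) * 2 powr ((real CARD('n) / 2 - 1) * e) * \<theta> ^ k)"
      by (simp only: One_nat_def sum.atLeast1_atMost_eq diff_Suc_Suc diff_zero term_eq)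
    also have "\<dots> = 2 powr p * T * (1 - 2 powr (- p)) * 2 powr ((real CARD('n) / 2 - 1) * e) * (\<Sum>k<L. \<theta> ^ k)"
      by (simp add: sum_distrib_left)
    also have "ennreal (b0 + 2 powr p * w L * I + \<dots>) \<le> ennreal (b0 + 2 powr p * w L * I + S)"
    proof (intro ennreal_leI add_left_mono)
      have "(\<Sum>k<L. \<theta> ^ k) \<le> (\<Sum>k. \<theta> ^ k)"
        using \<theta> by (intro sum_le_suminf summable_geometric) auto
      then have "(\<Sum>k<L. \<theta> ^ k) \<le> 1 / (1 - \<theta>)" using \<theta> by (simp add: suminf_geometric)
      moreover have "2 powr (- p) \<le> 1" using pq by (simp add: powr_less_one less_imp_le)
      ultimately show "2 powr p * T * (1 - 2 powr (- p)) * 2 powr ((real CARD('n) / 2 - 1) * e) * (\<Sum>k<L. \<theta> ^ k) \<le> S"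
        unfolding S_def using T by (intro mult_left_mono) auto
    qed
    finally show ?thesis .
  qed
  have "(\<lambda>L. w L) \<longlonglongrightarrow> 0"
  proof -
    have "w L = (2 powr (- p)) ^ L" for L
      by (simp only: w_def powr_powr[symmetric] powr_realpow powr_gt_zero)
    then show ?thesis using pq by (simp add: LIMSEQ_power_zero powr_less_one)
  qed
  then have "(\<lambda>L. ennreal (b0 + 2 powr p * w L * I + S)) \<longlonglongrightarrow> ennreal (b0 + 2 powr p * 0 * I + S)"
    by (intro tendsto_ennrealI tendsto_intros)
  then have "(\<integral>\<^sup>+ \<omega>. transport_cost p (\<mu>\<^sub>N \<omega>) \<mu> \<partial>M) \<le> ennreal (b0 + 2 powr p * 0 * I + S)"
    by (rule LIMSEQ_le_const) (use finite_levels in blast)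
  also have "b0 + 2 powr p * 0 * I + S = 2 powr p * (eps_const p * (2 * 2 powr (- e))
      + 2 powr ((real CARD('n) / 2 - 1) * e) * ((1 - 2 powr (- p)) / (1 - \<theta>))) * T"
  proof -
    have "b0 = 2 powr p * (eps_const p * (2 * 2 powr (- e))) * T" by (simp add: b0_def)
    moreover have "S = 2 powr p * (2 powr ((real CARD('n) / 2 - 1) * e) * ((1 - 2 powr (- p)) / (1 - \<theta>))) * T"
      by (simp add: S_def)
    ultimately show ?thesis
      by (simp only: distrib_left distrib_right mult_zero_left mult_zero_right add_0_right)
  qed
  also have "2 * 2 powr (- e) = 2 powr (2 * p / q - 1)"
  proof -
    have "2 * 2 powr (- e) = 2 powr (1 - e)" by (simp add: powr_diff powr_minus divide_inverse)
    also have "1 - e = 2 * p / q - 1" using pq by (simp add: e_def field_simps)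
    finally show ?thesis .
  qed
  finally show ?thesis
    by (simp add: T_def e_def \<theta>_def mult_ac)
qed

end

lemma cell_count_constant_le:
  fixes d e :: real
  assumes "0 < d" "0 \<le> e"
  shows "2 powr ((d / 2 - 1) * e) \<le> (2 powr (d - 1) / (2 powr (d / 2) - 1)) powr e"
proof -
  have D: "2 powr (d / 2) > 1" using assms by (intro gr_one_powr) auto
  have "2 powr (d / 2 - 1) * (2 powr (d / 2) - 1) \<le> 2 powr (d / 2 - 1) * 2 powr (d / 2)"
    by (intro mult_left_mono) auto
  also have "\<dots> = 2 powr (d - 1)" by (simp flip: powr_add)
  finally have "2 powr (d / 2 - 1) \<le> 2 powr (d - 1) / (2 powr (d / 2) - 1)"
    using D by (simp add: pos_le_divide_eq)
  then have "(2 powr (d / 2 - 1)) powr e \<le> (2 powr (d - 1) / (2 powr (d / 2) - 1)) powr e"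
    using assms by (intro powr_mono2) auto
  then show ?thesis by (simp add: powr_powr)
qed

theorem theorem2:
  fixes \<mu> :: "(real ^ 'n) measure"
    and M :: "'w measure"
    and X :: "nat \<Rightarrow> 'w \<Rightarrow> real ^ 'n"
    and p q :: real
    and N :: nat
  assumes "0 < p" and "p < q"
    and "p \<ge> real CARD('n) / 2 \<Longrightarrow> q < 2 * p"
    and "p \<le> real CARD('n) / 2 \<Longrightarrow> q < real CARD('n) * p / (real CARD('n) - p)"
    and "prob_space \<mu>" and "sets \<mu> = sets borel"
    and "prob_space M"
    and "prob_space.indep_vars M (\<lambda>_. borel) X {1..}"
    and "\<And>k. k \<ge> 1 \<Longrightarrow> distr M borel (X k) = \<mu>"
    and "N \<ge> 1"
  shows "(\<integral>\<^sup>+ \<omega>. transport_cost p (empirical_measure N (\<lambda>k. X k \<omega>)) \<mu> \<partial>M)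
         \<le> ennreal (2 powr p) * ennreal_powr (moment q \<mu>) (p / q)
            * ennreal (zeta_const CARD('n) p q / real N powr ((q - p) / q))"
proof -
  let ?d = "CARD('n)"
  have q: "q < 2 * p" and d: "real ?d - p - real ?d * p / q < 0"
    using exponent_conditions[OF assms(1-4)] by blast+
  have zeta: "0 < zeta_const ?d p q"
    using assms(1-4) by (intro zeta_const_pos) auto
  interpret iid_sample M X \<mu> N
    using assms by (simp add: iid_sample_def iid_sample_axioms_def)
  show ?thesis
  proof (cases "moment q \<mu> = \<top>")
    case True
    have "ennreal (2 powr p) * ennreal_powr (moment q \<mu>) (p / q)
        * ennreal (zeta_const ?d p q / real N powr ((q - p) / q)) = \<top>"
      using zeta N by (simp add: True ennreal_powr_def ennreal_mult_top ennreal_top_mult)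
    then show ?thesis by simp
  next
    case False
    define K where "K = enn2real (moment q \<mu>)"
    have K: "moment q \<mu> = ennreal K" "0 \<le> K"
      using False by (auto simp: K_def top.not_eq_extremum)
    obtain a where a: "1 < a" "(INF a\<in>{1<..}. zeta_fun p q a) = zeta_fun p q a"
      using zeta_fun_attains_min[OF assms(1,2) q] by metis
    let ?A = "\<lambda>s. (eps_const p * 2 powr (2 * p / q - 1)
        + s * ((1 - 2 powr (- p)) / (1 - 2 powr (real ?d - p - real ?d * p / q)))) * zeta_fun p q a"
    have "(\<integral>\<^sup>+ \<omega>. transport_cost p (\<mu>\<^sub>N \<omega>) \<mu> \<partial>M)
      \<le> ennreal (2 powr p * K powr (p / q)
          * ?A (2 powr ((real ?d / 2 - 1) * (2 * (q - p) / q))) / real N powr ((q - p) / q))"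
      by (rule expected_transport_cost_le[OF a(1) assms(1,2) q d K])
    also have "\<dots> \<le> ennreal (2 powr p * K powr (p / q)
          * zeta_const ?d p q / real N powr ((q - p) / q))"
      unfolding zeta_const_def a(2)
    proof (intro ennreal_leI divide_right_mono mult_left_mono mult_right_mono add_left_mono cell_count_constant_le)
      show "0 \<le> (1 - 2 powr (- p)) / (1 - 2 powr (real ?d - p - real ?d * p / q))"
        using assms(1) d by (intro divide_nonneg_nonneg) (auto simp: powr_less_one less_imp_le)
    qed (use assms zeta_fun_pos[OF assms(1,2) q a(1)] in auto)
    also have "\<dots> = ennreal (2 powr p) * ennreal_powr (moment q \<mu>) (p / q)
            * ennreal (zeta_const ?d p q / real N powr ((q - p) / q))"
      using zeta K False by (simp add: ennreal_powr_def ennreal_mult[symmetric] K_def[symmetric])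
    finally show ?thesis .
  qed
qed

end
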